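(* In variables $z, x_1, x_2, \ldots, y_1, y_2, \ldots$ let $e_1 = f_1 = 1$ and, for $i \geq 1$, let $e_{i+1} = (e_i \cdots e_1 z f_1 \cdots f_i x_i)^\omega$ and $f_{i+1} = (y_i e_i \cdots e_1 z f_1 \cdots f_i)^\omega$. Then for all integers $m \geq 2$ we have $$\mathbf{R}_m = [\![e_m \cdots e_1 z f_1 \cdots f_{m-1} = e_m \cdots e_1 f_1 \cdots f_{m-1}]\!],$$ $$\mathbf{L}_m = [\![e_{m-1} \cdots e_1 z f_1 \cdots f_m = e_{m-1} \cdots e_1 f_1 \cdots f_m]\!].$$
   Context: A variety is a class of finite monoids closed under submonoids, homomorphic images and finite direct products. Omega-terms over a set of variables $\Sigma$ are defined inductively: $1$ and every $x \in \Sigma$ are omega-terms, and if $u,v$ are omega-terms then so are $uv$ and $(u)^\omega$. A homomorphism $\varphi : \Sigma^* \to M$ to a finite monoid $M$ extends to omega-terms by letting $\varphi(u^\omega)$ be the unique idempotent that is a positive power of $\varphi(u)$. A finite monoid $M$ satisfies $u = v$ if $\varphi(u) = \varphi(v)$ for every homomorphism $\varphi : \Sigma^* \to M$; the class of all finite monoids satisfying $u=v$ is denoted $[\![u = v]\!]$. For a finite monoid $M$ and $x,y\in M$: $x \mathrel{\mathcal{R}} y$ iff $xM = yM$, and $x \mathrel{\mathcal{L}} y$ iff $Mx = My$. Define congruences on $M$: $x \sim_K y$ iff for all idempotents $e$ of $M$, if $ex \mathrel{\mathcal{R}} e$ or $ey \mathrel{\mathcal{R}} e$, then $ex = ey$;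 and $x \sim_D y$ iff for all idempotents $e$ of $M$, if $xe \mathrel{\mathcal{L}} e$ or $ye \mathrel{\mathcal{L}} e$, then $xe = ye$. For a variety $\mathbf{V}$, let $\mathbf{K} ⓜ \mathbf{V}$ be the class of all finite monoids $M$ with $M/{\sim_K} \in \mathbf{V}$, and $\mathbf{D} ⓜ \mathbf{V}$ the class of all finite monoids $M$ with $M/{\sim_D} \in \mathbf{V}$. The Trotter-Weil hierarchy: $\mathbf{R}_2 = [\![(zx)^\omega z = (zx)^\omega]\!]$ (the $\mathcal{R}$-trivial finite monoids), $\mathbf{L}_2 = [\![z(yz)^\omega = (yz)^\omega]\!]$ (the $\mathcal{L}$-trivial finite monoids), and for $m \geq 2$, $\mathbf{R}_{m+1} = \mathbf{K} ⓜ \mathbf{L}_m$ and $\mathbf{L}_{m+1} = \mathbf{D} ⓜ \mathbf{R}_m$. *)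

theory Defs
  imports "HOL-Algebra.Group" "HOL-Algebra.Coset"
begin

section \<open>Omega-terms and the classes they define\<close>

datatype 'v omega_term =
    Unit
  | Var 'v
  | Times "'v omega_term" "'v omega_term"
  | Omega "'v omega_term"

text \<open>The empty product is the term 1, so a nonempty product carries a trailing factor 1.\<close>

definition prod_term :: "'v omega_term list \<Rightarrow> 'v omega_term" where
  "prod_term ts = foldr Times ts Unit"

definition word_monoid :: "'v list monoid" where
  "word_monoid = \<lparr>carrier = UNIV, mult = (@), one = []\<rparr>"

text \<open>Elements of \<^const>\<open>hom\<close> only preserve multiplication, so preservation of the
  identity is required separately.\<close>

definition monoid_hom :: "('a, 'c) monoid_scheme \<Rightarrow> ('b, 'd) monoid_scheme \<Rightarrow> ('a \<Rightarrow> 'b) set" where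
  "monoid_hom M N = {h \<in> hom M N. h \<one>\<^bsub>M\<^esub> = \<one>\<^bsub>N\<^esub>}"

definition idempotents :: "('a, 'c) monoid_scheme \<Rightarrow> 'a set" where
  "idempotents M = {e \<in> carrier M. e \<otimes>\<^bsub>M\<^esub> e = e}"

definition omega_power :: "('a, 'c) monoid_scheme \<Rightarrow> 'a \<Rightarrow> 'a" where
  "omega_power M a = (THE e. e \<in> idempotents M \<and> (\<exists>n::nat. n > 0 \<and> e = a [^]\<^bsub>M\<^esub> n))"

primrec eval_term :: "('a, 'c) monoid_scheme \<Rightarrow> ('v list \<Rightarrow> 'a) \<Rightarrow> 'v omega_term \<Rightarrow> 'a" where
  "eval_term M \<phi> Unit = \<one>\<^bsub>M\<^esub>"
| "eval_term M \<phi> (Var x) = \<phi> [x]"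
| "eval_term M \<phi> (Times u v) = eval_term M \<phi> u \<otimes>\<^bsub>M\<^esub> eval_term M \<phi> v"
| "eval_term M \<phi> (Omega u) = omega_power M (eval_term M \<phi> u)"

definition finite_monoid :: "('a, 'c) monoid_scheme \<Rightarrow> bool" where
  "finite_monoid M \<longleftrightarrow> monoid M \<and> finite (carrier M)"

definition satisfies :: "('a, 'c) monoid_scheme \<Rightarrow> 'v omega_term \<Rightarrow> 'v omega_term \<Rightarrow> bool" where
  "satisfies M u v \<longleftrightarrow> (\<forall>\<phi> \<in> monoid_hom word_monoid M. eval_term M \<phi> u = eval_term M \<phi> v)"

definition equation_class :: "'v omega_term \<Rightarrow> 'v omega_term \<Rightarrow> 'a monoid set" where
  "equation_class u v = {M. finite_monoid M \<and> satisfies M u v}"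


section \<open>The congruences and the operators K and D\<close>

definition green_R :: "('a, 'c) monoid_scheme \<Rightarrow> 'a \<Rightarrow> 'a \<Rightarrow> bool" where
  "green_R M x y \<longleftrightarrow> x <#\<^bsub>M\<^esub> carrier M = y <#\<^bsub>M\<^esub> carrier M"

definition green_L :: "('a, 'c) monoid_scheme \<Rightarrow> 'a \<Rightarrow> 'a \<Rightarrow> bool" where
  "green_L M x y \<longleftrightarrow> carrier M #>\<^bsub>M\<^esub> x = carrier M #>\<^bsub>M\<^esub> y"

definition sim_K :: "('a, 'c) monoid_scheme \<Rightarrow> 'a rel" where
  "sim_K M = {(x, y). x \<in> carrier M \<and> y \<in> carrier M \<and>
     (\<forall>e \<in> idempotents M. green_R M (e \<otimes>\<^bsub>M\<^esub> x) e \<or> green_R M (e \<otimes>\<^bsub>M\<^esub> y) e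
        \<longrightarrow> e \<otimes>\<^bsub>M\<^esub> x = e \<otimes>\<^bsub>M\<^esub> y)}"

definition sim_D :: "('a, 'c) monoid_scheme \<Rightarrow> 'a rel" where
  "sim_D M = {(x, y). x \<in> carrier M \<and> y \<in> carrier M \<and>
     (\<forall>e \<in> idempotents M. green_L M (x \<otimes>\<^bsub>M\<^esub> e) e \<or> green_L M (y \<otimes>\<^bsub>M\<^esub> e) e
        \<longrightarrow> x \<otimes>\<^bsub>M\<^esub> e = y \<otimes>\<^bsub>M\<^esub> e)}"

text \<open>For a congruence \<open>r\<close>, the product of two classes is the single class of
  \<open>a \<otimes> b\<close> for any representatives \<open>a\<close>, \<open>b\<close>; the union below ranges over equal sets.
  The elementwise product of the two classes may be strictly smaller.\<close>

definition quotient_monoid :: "('a, 'c) monoid_scheme \<Rightarrow> 'a rel \<Rightarrow> 'a set monoid" where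
  "quotient_monoid M r =
     \<lparr>carrier = carrier M // r,
      mult = (\<lambda>A B. \<Union>a\<in>A. \<Union>b\<in>B. r `` {a \<otimes>\<^bsub>M\<^esub> b}),
      one = r `` {\<one>\<^bsub>M\<^esub>}\<rparr>"

text \<open>A class of finite monoids is represented, for each carrier type \<open>'a\<close>, by the set of its
  members over \<open>'a\<close>. A quotient of such a monoid lives over \<open>'a set\<close>, so membership of the
  quotient in \<open>V\<close> is taken up to isomorphism. This loses nothing: the quotient has at most as
  many elements as the original monoid and hence has an isomorphic copy over \<open>'a\<close>.\<close>

definition in_class :: "('b, 'c) monoid_scheme \<Rightarrow> 'a monoid set \<Rightarrow> bool" where
  "in_class Q V \<longleftrightarrow> (\<exists>N \<in> V. Q \<cong> N)"

definition malcev_K :: "'a monoid set \<Rightarrow> 'a monoid set" where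
  "malcev_K V = {M. finite_monoid M \<and> in_class (quotient_monoid M (sim_K M)) V}"

definition malcev_D :: "'a monoid set \<Rightarrow> 'a monoid set" where
  "malcev_D V = {M. finite_monoid M \<and> in_class (quotient_monoid M (sim_D M)) V}"


section \<open>The Trotter-Weil hierarchy\<close>

datatype var = Vz | Vx nat | Vy nat

text \<open>The hierarchy starts at level 2; levels 0 and 1 are left unspecified.\<close>

fun TW_R :: "nat \<Rightarrow> 'a monoid set" and TW_L :: "nat \<Rightarrow> 'a monoid set" where
  "TW_R (Suc (Suc 0)) =
     equation_class
       (Times (Omega (Times (Var Vz) (Var (Vx 1)))) (Var Vz))
       (Omega (Times (Var Vz) (Var (Vx 1))))"
| "TW_L (Suc (Suc 0)) =
     equation_class
       (Times (Var Vz) (Omega (Times (Var (Vy 1)) (Var Vz))))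
       (Omega (Times (Var (Vy 1)) (Var Vz)))"
| "TW_R (Suc (Suc (Suc m))) = malcev_K (TW_L (Suc (Suc m)))"
| "TW_L (Suc (Suc (Suc m))) = malcev_D (TW_R (Suc (Suc m)))"


section \<open>The terms of the identities\<close>

text \<open>Indices start at 1; \<open>e_term 0\<close> and \<open>f_term 0\<close> are left unspecified.\<close>

fun e_term :: "nat \<Rightarrow> var omega_term" and f_term :: "nat \<Rightarrow> var omega_term" where
  "e_term (Suc i) =
     (if i = 0 then Unit
      else Omega (prod_term
        (map e_term (rev [1..<Suc i]) @ [Var Vz] @ map f_term [1..<Suc i] @ [Var (Vx i)])))"
| "f_term (Suc i) =
     (if i = 0 then Unit
      else Omega (prod_term
        ([Var (Vy i)] @ map e_term (rev [1..<Suc i]) @ [Var Vz] @ map f_term [1..<Suc i])))"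

end

theory Submission imports Defs begin

text \<open>
  Write \<open>u = e\<^sub>m\<^sub>-\<^sub>1 \<cdots> e\<^sub>1 z f\<^sub>1 \<cdots> f\<^sub>m\<close> and \<open>v = e\<^sub>m\<^sub>-\<^sub>1 \<cdots> e\<^sub>1 f\<^sub>1 \<cdots> f\<^sub>m\<close>. Since homomorphisms
  lift along quotient maps, \<open>M/\<sim>\<^sub>K\<close> satisfies \<open>u = v\<close> iff \<open>\<phi>(u) \<sim>\<^sub>K \<phi>(v)\<close> for all \<open>\<phi>\<close> into \<open>M\<close>.
  If this holds, apply it to the idempotent \<open>g = e\<^sub>m\<^sub>+\<^sub>1 e\<^sub>m\<close>, for which \<open>g u\<close> is
  \<open>\<R>\<close>-equivalent to \<open>g\<close>. Conversely, if \<open>e\<close> is idempotent and \<open>e u s = e\<close>, then choosing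
  \<open>x\<^sub>m\<^sub>-\<^sub>1 = f\<^sub>m s e\<close> and \<open>x\<^sub>m = s e\<close>, variables that do not occur in \<open>u\<close> and \<open>v\<close>, gives
  \<open>e e\<^sub>m\<^sub>+\<^sub>1 e\<^sub>m = e\<close>, and the identity yields \<open>e u = e v\<close>. If instead \<open>e v s = e\<close>, one uses that the
  identity forces \<open>M\<close> into the variety DA: the elements \<open>b\<close> with \<open>e b e = e\<close> are closed under
  factors and products. Hence they contain \<open>u\<close> and the first case applies.
  The statement for \<open>L\<^sub>m\<close> is the one for \<open>R\<^sub>m\<close> in the opposite monoid.
\<close>

section \<open>Omega powers and homomorphisms\<close>

lemma (in monoid) idempotent_pow:
  assumes "e \<in> carrier G" "e \<otimes> e = e" "n > 0"
  shows "e [^] (n::nat) = e"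
  using assms(3)
proof (induction n rule: nat_induct_non_zero)
  case 1 then show ?case using assms by simp
next
  case (Suc n) then show ?case using assms by simp
qed

text \<open>An idempotent equals all its positive powers, so \<open>e\<close> and \<open>f\<close>
  both coincide with the power of \<open>a\<close> with exponent \<open>n * m\<close>.\<close>

lemma (in monoid) idempotent_power_unique:
  assumes a: "a \<in> carrier G" and "n > 0" "m > 0"
    and "e \<otimes> e = e" "e = a [^] (n::nat)" and "f \<otimes> f = f" "f = a [^] (m::nat)"
  shows "e = f"
proof -
  have "e = e [^] m" "f = f [^] n"
    using assms idempotent_pow[of e m] idempotent_pow[of f n] by auto
  moreover have "e [^] m = f [^] n"
    using assms by (simp add: nat_pow_pow mult.commute)
  ultimately show ?thesis by simp
qed

text \<open>By the pigeonhole principle two powers of \<open>a\<close> coincide, so the powers are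
  periodic from some exponent \<open>i\<close> on. An exponent beyond \<open>i\<close> that is a
  multiple of the period gives an idempotent.\<close>

lemma idempotent_power_exists:
  assumes "finite_monoid M" "a \<in> carrier M"
  shows "\<exists>n::nat. n > 0 \<and> a [^]\<^bsub>M\<^esub> n \<in> idempotents M"
proof -
  interpret monoid M using assms by (simp add: finite_monoid_def)
  have "finite (range (\<lambda>n::nat. a [^]\<^bsub>M\<^esub> n))"
    by (rule finite_subset[of _ "carrier M"]) (use assms in \<open>auto simp: finite_monoid_def\<close>)
  then have "\<not> inj (\<lambda>n::nat. a [^]\<^bsub>M\<^esub> n)"
    using finite_imageD infinite_UNIV_nat by blast
  then obtain i j :: nat where ij: "i < j" "a [^]\<^bsub>M\<^esub> i = a [^]\<^bsub>M\<^esub> j"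
    by (metis injI nat_neq_iff)
  define p where "p = j - i"
  have p: "p > 0" "a [^]\<^bsub>M\<^esub> (i + p) = a [^]\<^bsub>M\<^esub> i" using ij by (auto simp: p_def)
  have step: "a [^]\<^bsub>M\<^esub> (i + d + p) = a [^]\<^bsub>M\<^esub> (i + d)" for d
  proof -
    have "a [^]\<^bsub>M\<^esub> (i + d + p) = a [^]\<^bsub>M\<^esub> (i + p) \<otimes>\<^bsub>M\<^esub> a [^]\<^bsub>M\<^esub> d"
      using assms by (simp add: nat_pow_mult ac_simps)
    then show ?thesis using assms p by (simp add: nat_pow_mult)
  qed
  have steps: "a [^]\<^bsub>M\<^esub> (i + d + k * p) = a [^]\<^bsub>M\<^esub> (i + d)" for d k
  proof (induction k)
    case (Suc k)
    have "i + d + Suc k * p = i + (d + k * p) + p" "i + (d + k * p) = i + d + k * p" by simp_all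
    then show ?case using step[of "d + k * p"] Suc.IH by metis
  qed simp
  \<comment> \<open>A multiple of the period that is at least \<open>i\<close>; the
    \<open>Suc\<close> keeps it positive when \<open>i = 0\<close>. Adding \<open>Suc i\<close>
    periods to the exponent \<open>t\<close> gives \<open>t + t\<close>.\<close>
  define t where "t = Suc i * p"
  have "i * 1 \<le> i * p" using p(1) by (intro mult_le_mono) simp_all
  then have "i \<le> t" by (simp add: t_def trans_le_add2)
  then have "a [^]\<^bsub>M\<^esub> (t + t) = a [^]\<^bsub>M\<^esub> t"
    using steps[of "t - i" "Suc i"] unfolding t_def[symmetric] by simp
  then have "a [^]\<^bsub>M\<^esub> t \<in> idempotents M"
    using assms by (simp add: idempotents_def nat_pow_mult)
  moreover have "t > 0" using p(1) by (simp add: t_def)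
  ultimately show ?thesis by blast
qed

lemma omega_power_eqI:
  assumes "finite_monoid M" "a \<in> carrier M" "e \<in> idempotents M" "e = a [^]\<^bsub>M\<^esub> (n::nat)" "n > 0"
  shows "omega_power M a = e"
proof -
  interpret monoid M using assms by (simp add: finite_monoid_def)
  show ?thesis unfolding omega_power_def
  proof (rule the_equality)
    fix f assume "f \<in> idempotents M \<and> (\<exists>n::nat. n > 0 \<and> f = a [^]\<^bsub>M\<^esub> n)"
    then obtain m :: nat where "m > 0" "f = a [^]\<^bsub>M\<^esub> m" "f \<otimes>\<^bsub>M\<^esub> f = f"
      by (auto simp: idempotents_def)
    then show "f = e"
      using idempotent_power_unique[OF assms(2), of m n f e] assms by (simp add: idempotents_def)
  qed (use assms in blast)
qed

lemma omega_powerE: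
  assumes "finite_monoid M" "a \<in> carrier M"
  obtains n :: nat where "n > 0" "omega_power M a = a [^]\<^bsub>M\<^esub> n" "omega_power M a \<in> idempotents M"
  by (metis assms idempotent_power_exists omega_power_eqI)

lemma omega_power_closed:
  "finite_monoid M \<Longrightarrow> a \<in> carrier M \<Longrightarrow> omega_power M a \<in> carrier M"
  by (erule (1) omega_powerE) (simp add: idempotents_def)

lemma omega_power_idem:
  "finite_monoid M \<Longrightarrow> a \<in> carrier M \<Longrightarrow>
    omega_power M a \<otimes>\<^bsub>M\<^esub> omega_power M a = omega_power M a"
  by (erule (1) omega_powerE) (simp add: idempotents_def)

lemma omega_power_of_idempotent:
  assumes "finite_monoid M" "a \<in> carrier M" "a \<otimes>\<^bsub>M\<^esub> a = a"
  shows "omega_power M a = a"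
proof -
  interpret monoid M using assms by (simp add: finite_monoid_def)
  show ?thesis
    by (rule omega_power_eqI[of _ _ _ 1]) (use assms in \<open>auto simp: idempotents_def\<close>)
qed

lemma omega_power_unfold:
  assumes "finite_monoid M" "a \<in> carrier M"
  obtains b where "b \<in> carrier M" "omega_power M a = a \<otimes>\<^bsub>M\<^esub> b"
proof -
  interpret monoid M using assms by (simp add: finite_monoid_def)
  obtain n :: nat where n: "n > 0" "omega_power M a = a [^]\<^bsub>M\<^esub> n"
    using omega_powerE[OF assms] by metis
  then obtain k where "n = Suc k" using gr0_implies_Suc by blast
  with n assms have "omega_power M a = a \<otimes>\<^bsub>M\<^esub> a [^]\<^bsub>M\<^esub> k" by (simp only: nat_pow_Suc2)
  with that assms show ?thesis by blast
qed

text \<open>If right multiplication by \<open>a\<close> fixes \<open>e\<close>, then so does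
  multiplication by every power of \<open>a\<close>, and the omega power is one of them.\<close>

lemma mult_omega_power_absorb:
  assumes "finite_monoid M" "e \<in> carrier M" "a \<in> carrier M" "e \<otimes>\<^bsub>M\<^esub> a = e"
  shows "e \<otimes>\<^bsub>M\<^esub> omega_power M a = e"
proof -
  interpret monoid M using assms by (simp add: finite_monoid_def)
  have "e \<otimes>\<^bsub>M\<^esub> a [^]\<^bsub>M\<^esub> (n::nat) = e" for n
    by (induction n) (use assms in \<open>simp_all add: m_assoc[symmetric]\<close>)
  then show ?thesis using omega_powerE[OF assms(1,3)] by metis
qed

section \<open>Homomorphisms, evaluation of terms and lifting along surjections\<close>

text \<open>The monoid laws of \<open>N\<close> are inherited through the surjection, so neither
  quotients nor their transported copies need a separate verification.\<close>

lemma finite_monoid_hom_image: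
  assumes "finite_monoid M" "h \<in> monoid_hom M N" "h ` carrier M = carrier N"
  shows "finite_monoid N"
proof -
  interpret monoid M using assms by (simp add: finite_monoid_def)
  have h: "h (x \<otimes>\<^bsub>M\<^esub> y) = h x \<otimes>\<^bsub>N\<^esub> h y" if "x \<in> carrier M" "y \<in> carrier M" for x y
    using assms that by (auto simp: monoid_hom_def hom_def)
  have one: "\<one>\<^bsub>N\<^esub> = h \<one>\<^bsub>M\<^esub>" using assms by (auto simp: monoid_hom_def)
  have "monoid N"
  proof (rule monoidI; unfold assms(3)[symmetric])
    fix x y assume "x \<in> h ` carrier M" "y \<in> h ` carrier M"
    then show "x \<otimes>\<^bsub>N\<^esub> y \<in> h ` carrier M" using h by (metis (no_types, lifting) image_iff m_closed)
  qed (auto simp: one h[symmetric] m_assoc)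
  with assms show ?thesis by (metis finite_imageI finite_monoid_def)
qed

lemma eval_term_closed:
  assumes "finite_monoid M" "\<phi> \<in> monoid_hom word_monoid M"
  shows "eval_term M \<phi> t \<in> carrier M"
proof -
  interpret monoid M using assms by (simp add: finite_monoid_def)
  show ?thesis using assms
    by (induction t) (auto simp: omega_power_closed monoid_hom_def hom_def word_monoid_def)
qed

text \<open>The image of an idempotent power of \<open>a\<close> is an idempotent power of
  \<open>h a\<close>, and there is only one such element.\<close>

lemma hom_omega_power:
  assumes "finite_monoid M" "finite_monoid N" "h \<in> monoid_hom M N" "a \<in> carrier M"
  shows "h (omega_power M a) = omega_power N (h a)"
proof -
  interpret M: monoid M using assms by (simp add: finite_monoid_def)
  interpret N: monoid N using assms by (simp add: finite_monoid_def)
  have h: "h (x \<otimes>\<^bsub>M\<^esub> y) = h x \<otimes>\<^bsub>N\<^esub> h y" "h x \<in> carrier N" if "x \<in> carrier M" "y \<in> carrier M" for x y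
    using assms that by (auto simp: monoid_hom_def hom_def)
  have one: "h \<one>\<^bsub>M\<^esub> = \<one>\<^bsub>N\<^esub>" using assms by (auto simp: monoid_hom_def)
  have pow: "h (a [^]\<^bsub>M\<^esub> n) = h a [^]\<^bsub>N\<^esub> n" for n :: nat
    by (induction n) (use assms in \<open>simp_all add: h one\<close>)
  obtain n :: nat where n: "n > 0" "omega_power M a = a [^]\<^bsub>M\<^esub> n"
    using omega_powerE[OF assms(1,4)] by metis
  have "h (omega_power M a) \<in> idempotents N"
    using omega_power_idem[OF assms(1,4)] omega_power_closed[OF assms(1,4)] h
    by (auto simp: idempotents_def h(1)[symmetric])
  with n pow show ?thesis
    using omega_power_eqI[OF assms(2), of "h a" "h (omega_power M a)" n] h assms by auto
qed

text \<open>Evaluation reads its second argument on one-letter words only, which is why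
  \<open>\<psi>\<close> is tied to \<open>h \<circ> \<phi>\<close> just there.\<close>

lemma hom_eval_term:
  assumes "finite_monoid M" "finite_monoid N" "h \<in> monoid_hom M N" "\<phi> \<in> monoid_hom word_monoid M"
    and "\<And>v. \<psi> [v] = h (\<phi> [v])"
  shows "h (eval_term M \<phi> t) = eval_term N \<psi> t"
proof (induction t)
  case Unit then show ?case using assms by (auto simp: monoid_hom_def)
next
  case (Times t u) then show ?case
    using assms eval_term_closed[OF assms(1,4)] by (auto simp: monoid_hom_def hom_def)
next
  case (Omega t) then show ?case
    by (simp add: hom_omega_power[OF assms(1-3)] eval_term_closed[OF assms(1,4)])
qed (simp add: assms)

lemma monoid_hom_word_extend:
  assumes "monoid M" "range a \<subseteq> carrier M"
  obtains \<phi> where "\<phi> \<in> monoid_hom word_monoid M" "\<And>v. \<phi> [v] = a v"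
proof -
  interpret monoid M by fact
  define \<phi> where "\<phi> = (\<lambda>w. foldr (\<lambda>v p. a v \<otimes>\<^bsub>M\<^esub> p) w \<one>\<^bsub>M\<^esub>)"
  have a: "a v \<in> carrier M" for v using assms by auto
  have c: "\<phi> w \<in> carrier M" for w by (induction w) (auto simp: \<phi>_def a)
  have "\<phi> (v @ w) = \<phi> v \<otimes>\<^bsub>M\<^esub> \<phi> w" for v w
    by (induction v) (use c in \<open>auto simp: \<phi>_def a m_assoc\<close>)
  then have "\<phi> \<in> monoid_hom word_monoid M"
    using c by (auto simp: monoid_hom_def hom_def word_monoid_def \<phi>_def)
  moreover have "\<phi> [v] = a v" for v by (simp add: \<phi>_def a)
  ultimately show ?thesis using that by blast
qed

text \<open>From left to right, homomorphisms into \<open>M\<close> are composed with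
  \<open>h\<close>. Conversely, every homomorphism into \<open>N\<close> lifts to \<open>M\<close>:
  preimages of the letter values are chosen, and freeness of the word monoid extends the
  choice.\<close>

lemma satisfies_hom_image:
  fixes u v :: "'v omega_term"
  assumes "finite_monoid M" "h \<in> monoid_hom M N" "h ` carrier M = carrier N"
  shows "satisfies N u v \<longleftrightarrow>
    (\<forall>\<phi> \<in> monoid_hom word_monoid M. h (eval_term M \<phi> u) = h (eval_term M \<phi> v))"
proof -
  have N: "finite_monoid N" using finite_monoid_hom_image[OF assms] .
  have mono: "monoid M" "monoid N" using assms N by (auto simp: finite_monoid_def)
  show ?thesis
  proof
    assume sat: "satisfies N u v"
    show "\<forall>\<phi> \<in> monoid_hom word_monoid M. h (eval_term M \<phi> u) = h (eval_term M \<phi> v)"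
    proof
      fix \<phi> :: "'v list \<Rightarrow> _" assume \<phi>: "\<phi> \<in> monoid_hom word_monoid M"
      then have "h \<circ> \<phi> \<in> monoid_hom word_monoid N"
        using assms(2) by (auto simp: monoid_hom_def hom_def Pi_iff word_monoid_def)
      then show "h (eval_term M \<phi> u) = h (eval_term M \<phi> v)"
        using sat hom_eval_term[OF assms(1) N assms(2) \<phi>, of "h \<circ> \<phi>"] by (simp add: satisfies_def)
    qed
  next
    assume *: "\<forall>\<phi> \<in> monoid_hom word_monoid M. h (eval_term M \<phi> u) = h (eval_term M \<phi> v)"
    show "satisfies N u v" unfolding satisfies_def
    proof
      fix \<psi> :: "'v list \<Rightarrow> _" assume "\<psi> \<in> monoid_hom word_monoid N"
      then have "\<forall>v. \<exists>x. x \<in> carrier M \<and> \<psi> [v] = h x"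
        using assms(3) by (auto simp: monoid_hom_def hom_def Pi_iff word_monoid_def image_iff)
      then obtain a where a: "\<And>v. a v \<in> carrier M" "\<And>v. \<psi> [v] = h (a v)" by metis
      obtain \<phi> where \<phi>: "\<phi> \<in> monoid_hom word_monoid M" "\<And>v. \<phi> [v] = a v"
        using monoid_hom_word_extend[OF mono(1), of a] a by blast
      show "eval_term N \<psi> u = eval_term N \<psi> v"
        using * \<phi> a hom_eval_term[OF assms(1) N assms(2) \<phi>(1), of \<psi>] by metis
    qed
  qed
qed

section \<open>Quotients by congruences\<close>

definition congruence :: "('a, 'c) monoid_scheme \<Rightarrow> 'a rel \<Rightarrow> bool" where
  "congruence M r \<longleftrightarrow> equiv (carrier M) r \<and>
     (\<forall>x y. \<forall>c \<in> carrier M. (x, y) \<in> r \<longrightarrow>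
        (x \<otimes>\<^bsub>M\<^esub> c, y \<otimes>\<^bsub>M\<^esub> c) \<in> r \<and> (c \<otimes>\<^bsub>M\<^esub> x, c \<otimes>\<^bsub>M\<^esub> y) \<in> r)"

text \<open>All sets in the defining union are equal by compatibility of \<open>r\<close>; since
  both classes are nonempty, the union is that common set.\<close>

lemma quotient_monoid_mult:
  assumes "congruence M r" "a \<in> carrier M" "b \<in> carrier M"
  shows "r `` {a} \<otimes>\<^bsub>quotient_monoid M r\<^esub> r `` {b} = r `` {a \<otimes>\<^bsub>M\<^esub> b}"
proof -
  have eq: "equiv (carrier M) r" using assms by (simp add: congruence_def)
  have cl: "c \<in> carrier M" if "(a, c) \<in> r" for a c
    using that eq by (metis SigmaE2 equiv_def equiv_type subsetD)
  have *: "r `` {c \<otimes>\<^bsub>M\<^esub> d} = r `` {a \<otimes>\<^bsub>M\<^esub> b}" if "(a, c) \<in> r" "(b, d) \<in> r" for c d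
  proof -
    have "(a \<otimes>\<^bsub>M\<^esub> b, c \<otimes>\<^bsub>M\<^esub> b) \<in> r" "(c \<otimes>\<^bsub>M\<^esub> b, c \<otimes>\<^bsub>M\<^esub> d) \<in> r"
      using assms that cl by (auto simp: congruence_def)
    then show ?thesis by (metis eq equiv_class_eq)
  qed
  have "(\<Union>c\<in>r `` {a}. \<Union>d\<in>r `` {b}. r `` {c \<otimes>\<^bsub>M\<^esub> d}) =
      (\<Union>c\<in>r `` {a}. \<Union>d\<in>r `` {b}. r `` {a \<otimes>\<^bsub>M\<^esub> b})"
    by (intro SUP_cong refl) (rule *; blast)
  moreover have "r `` {a} \<noteq> {}" "r `` {b} \<noteq> {}"
    using equiv_class_self[OF eq] assms by blast+
  ultimately show ?thesis by (simp add: quotient_monoid_def)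
qed

lemma monoid_hom_quotient:
  assumes "finite_monoid M" "congruence M r"
  shows "(\<lambda>a. r `` {a}) \<in> monoid_hom M (quotient_monoid M r)"
    and "(\<lambda>a. r `` {a}) ` carrier M = carrier (quotient_monoid M r)"
proof -
  show *: "(\<lambda>a. r `` {a}) ` carrier M = carrier (quotient_monoid M r)"
    by (auto simp: quotient_monoid_def quotient_def)
  show "(\<lambda>a. r `` {a}) \<in> monoid_hom M (quotient_monoid M r)"
    using * quotient_monoid_mult[OF assms(2)]
    by (auto simp: monoid_hom_def hom_def) (simp_all add: quotient_monoid_def)
qed

text \<open>Any copy \<open>N\<close> of the quotient is an image of \<open>M\<close> under a
  homomorphism with kernel \<open>r\<close>, so \<open>satisfies_hom_image\<close> turns equality of
  values in \<open>N\<close> into relatedness in \<open>M\<close>. From right to left a copy over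
  the type \<open>'a\<close> has to be constructed.\<close>

lemma in_class_quotient_iff:
  fixes M :: "'a monoid"
  assumes M: "finite_monoid M" and r: "congruence M r"
  shows "in_class (quotient_monoid M r) (equation_class u v :: 'a monoid set) \<longleftrightarrow>
    (\<forall>\<phi> \<in> monoid_hom word_monoid M. (eval_term M \<phi> u, eval_term M \<phi> v) \<in> r)"
    (is "_ \<longleftrightarrow> ?R")
proof -
  let ?Q = "quotient_monoid M r" and ?p = "\<lambda>a. r `` {a}"
  interpret monoid M using M by (simp add: finite_monoid_def)
  note p = monoid_hom_quotient[OF M r]
  have eq: "equiv (carrier M) r" using r by (simp add: congruence_def)
  have key: "satisfies N u v \<longleftrightarrow> ?R"
    if "i \<circ> ?p \<in> monoid_hom M N" "inj_on i (carrier ?Q)" "i ` carrier ?Q = carrier N" for i N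
  proof -
    have img: "(i \<circ> ?p) ` carrier M = carrier N" using that p by (metis image_comp)
    have "i (?p a) = i (?p b) \<longleftrightarrow> (a, b) \<in> r" if "a \<in> carrier M" "b \<in> carrier M" for a b
    proof -
      have "?p a \<in> carrier ?Q" "?p b \<in> carrier ?Q" using p(2) that by auto
      then show ?thesis
        using \<open>inj_on i _\<close> eq_equiv_class_iff[OF eq that] by (auto dest: inj_onD)
    qed
    then show ?thesis
      unfolding satisfies_hom_image[OF M that(1) img] comp_def
      by (intro ball_cong refl) (simp add: eval_term_closed[OF M])
  qed
  show ?thesis
  proof
    assume "in_class ?Q (equation_class u v :: 'a monoid set)"
    then obtain N :: "'a monoid" and i
      where N: "finite_monoid N" "satisfies N u v" and i: "i \<in> hom ?Q N" "bij_betw i (carrier ?Q) (carrier N)"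
      by (auto simp: in_class_def equation_class_def is_iso_def iso_def)
    interpret N: monoid N using N by (simp add: finite_monoid_def)
    have ip: "i \<circ> ?p \<in> hom M N" using p i by (auto simp: monoid_hom_def hom_def Pi_iff)
    have img: "(i \<circ> ?p) ` carrier M = carrier N" using i p by (metis bij_betw_def image_comp)
    \<comment> \<open>An isomorphism in the sense of \<open>iso\<close> is only required to be
      multiplicative. The identity is preserved because \<open>c\<close>, a preimage of the identity
      of \<open>N\<close>, satisfies \<open>\<one> \<otimes> c = c\<close>.\<close>
    have one: "(i \<circ> ?p) \<one>\<^bsub>M\<^esub> = \<one>\<^bsub>N\<^esub>"
    proof -
      obtain c where c: "c \<in> carrier M" "(i \<circ> ?p) c = \<one>\<^bsub>N\<^esub>" using img N.one_closed by (metis (no_types, lifting) imageE)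
      have "(i \<circ> ?p) (\<one>\<^bsub>M\<^esub> \<otimes>\<^bsub>M\<^esub> c) = (i \<circ> ?p) \<one>\<^bsub>M\<^esub> \<otimes>\<^bsub>N\<^esub> (i \<circ> ?p) c"
        using ip c one_closed unfolding hom_def by blast
      moreover have "(i \<circ> ?p) \<one>\<^bsub>M\<^esub> \<in> carrier N" using ip unfolding hom_def by blast
      ultimately show ?thesis using c by (metis N.r_one l_one)
    qed
    have "i \<circ> ?p \<in> monoid_hom M N" using ip one by (simp add: monoid_hom_def)
    then show ?R using key[of i N] i N by (auto simp: bij_betw_def)
  next
    assume R: ?R
    \<comment> \<open>\<open>s\<close> chooses a representative in each class. Transporting the
      quotient along \<open>s\<close> gives an isomorphic monoid whose elements are again of type
      \<open>'a\<close>.\<close>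
    define s where "s = (\<lambda>A. SOME a. a \<in> (A :: 'a set))"
    have s: "?p (s A) = A" if A: "A \<in> carrier ?Q" for A
    proof -
      obtain a where a: "a \<in> carrier M" "A = ?p a" using A p by auto
      then have "a \<in> A" using eq by (metis equiv_class_self)
      then have "s A \<in> A" by (metis s_def someI)
      then show ?thesis using a by (metis Image_singleton_iff eq equiv_class_eq)
    qed
    have inj: "inj_on s (carrier ?Q)" using s by (metis inj_onI)
    define N where "N = \<lparr>carrier = s ` carrier ?Q,
      mult = (\<lambda>a b. s (?p a \<otimes>\<^bsub>?Q\<^esub> ?p b)), one = s \<one>\<^bsub>?Q\<^esub>\<rparr>"
    have cl: "A \<otimes>\<^bsub>?Q\<^esub> B \<in> carrier ?Q" if "A \<in> carrier ?Q" "B \<in> carrier ?Q" for A B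
      using that p finite_monoid_hom_image[OF M p] by (metis finite_monoid_def monoid.m_closed)
    have hom: "s \<in> hom ?Q N" by (auto simp: hom_def N_def s cl)
    have mh: "s \<circ> ?p \<in> monoid_hom M N"
      using hom p by (auto simp: monoid_hom_def hom_def Pi_iff N_def)
    have "(s \<circ> ?p) ` carrier M = carrier N"
      unfolding image_comp[symmetric] p(2) by (simp add: N_def)
    then have "finite_monoid N" using finite_monoid_hom_image[OF M mh] by blast
    moreover have "satisfies N u v" using key[OF mh inj] R by (simp add: N_def)
    moreover have "?Q \<cong> N"
      using hom inj by (auto simp: is_iso_def iso_def bij_betw_def N_def)
    ultimately show "in_class ?Q (equation_class u v :: 'a monoid set)"
      by (auto simp: in_class_def equation_class_def)
  qed
qed

section \<open>Green's relation R and the congruence property of \<open>sim_K\<close>\<close>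

text \<open>The right ideal of \<open>e x\<close> always lies in that of \<open>e\<close>. The other
  inclusion amounts to \<open>e\<close> lying in the smaller ideal, as the monoid has an
  identity.\<close>

lemma (in monoid) green_R_mult_iff:
  assumes "e \<in> carrier G" "x \<in> carrier G"
  shows "green_R G (e \<otimes> x) e \<longleftrightarrow> (\<exists>s \<in> carrier G. e \<otimes> x \<otimes> s = e)"
proof
  assume "green_R G (e \<otimes> x) e"
  moreover have "e \<in> e <# carrier G" using assms by (auto simp: l_coset_def intro!: bexI[of _ \<one>])
  ultimately have "e \<in> (e \<otimes> x) <# carrier G" by (simp add: green_R_def)
  then show "\<exists>s \<in> carrier G. e \<otimes> x \<otimes> s = e" unfolding l_coset_def by force
next
  assume "\<exists>s \<in> carrier G. e \<otimes> x \<otimes> s = e"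
  then obtain s where s: "s \<in> carrier G" "e \<otimes> x \<otimes> s = e" by blast
  have "\<exists>b \<in> carrier G. e \<otimes> a = e \<otimes> x \<otimes> b" if "a \<in> carrier G" for a
    by (rule bexI[of _ "s \<otimes> a"]) (use s assms that in \<open>simp_all add: m_assoc[symmetric]\<close>)
  moreover have "\<exists>b \<in> carrier G. e \<otimes> x \<otimes> a = e \<otimes> b" if "a \<in> carrier G" for a
    by (rule bexI[of _ "x \<otimes> a"]) (use assms that in \<open>simp_all add: m_assoc\<close>)
  ultimately show "green_R G (e \<otimes> x) e" by (auto simp: green_R_def l_coset_def)
qed

lemma sim_K_D:
  assumes "(x, y) \<in> sim_K M" "e \<in> idempotents M"
    and "green_R M (e \<otimes>\<^bsub>M\<^esub> x) e \<or> green_R M (e \<otimes>\<^bsub>M\<^esub> y) e"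
  shows "e \<otimes>\<^bsub>M\<^esub> x = e \<otimes>\<^bsub>M\<^esub> y"
  using assms unfolding sim_K_def by blast

lemma sim_K_I:
  assumes "x \<in> carrier M" "y \<in> carrier M"
    and "\<And>e. e \<in> idempotents M \<Longrightarrow> green_R M (e \<otimes>\<^bsub>M\<^esub> x) e \<or> green_R M (e \<otimes>\<^bsub>M\<^esub> y) e \<Longrightarrow>
      e \<otimes>\<^bsub>M\<^esub> x = e \<otimes>\<^bsub>M\<^esub> y"
  shows "(x, y) \<in> sim_K M"
  using assms(1,2) by (simp add: sim_K_def) (use assms(3) in blast)

lemma sim_K_carrier: "(x, y) \<in> sim_K M \<Longrightarrow> x \<in> carrier M \<and> y \<in> carrier M"
  by (simp add: sim_K_def)

text \<open>For transitivity, \<open>e x\<close> R \<open>e\<close> gives \<open>e x = e y\<close>,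
  hence \<open>e y\<close> R \<open>e\<close>, and the second relation applies. A right factor
  \<open>c\<close> is harmless because \<open>e w c\<close> R \<open>e\<close> forces
  \<open>e w\<close> R \<open>e\<close>. For a left factor \<open>c\<close> the relation is applied
  to a conjugate idempotent instead of \<open>e\<close>.\<close>

lemma sim_K_congruence:
  assumes "monoid M"
  shows "congruence M (sim_K M)"
proof -
  interpret monoid M by fact
  have "equiv (carrier M) (sim_K M)"
  proof (rule equivI)
    show "sym (sim_K M)"
    proof (rule symI)
      fix x y assume xy: "(x, y) \<in> sim_K M"
      show "(y, x) \<in> sim_K M"
        by (rule sim_K_I) (use sim_K_carrier[OF xy] sim_K_D[OF xy] in metis)+
    qed
    show "trans (sim_K M)"
    proof (rule transI)
      fix x y z assume xy: "(x, y) \<in> sim_K M" and yz: "(y, z) \<in> sim_K M"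
      show "(x, z) \<in> sim_K M"
      proof (rule sim_K_I)
        fix e assume "e \<in> idempotents M" "green_R M (e \<otimes>\<^bsub>M\<^esub> x) e \<or> green_R M (e \<otimes>\<^bsub>M\<^esub> z) e"
        then show "e \<otimes>\<^bsub>M\<^esub> x = e \<otimes>\<^bsub>M\<^esub> z"
          using sim_K_D[OF xy, of e] sim_K_D[OF yz, of e] by metis
      qed (use sim_K_carrier[OF xy] sim_K_carrier[OF yz] in simp_all)
    qed
    show "refl_on (carrier M) (sim_K M)" by (rule refl_onI) (auto intro: sim_K_I)
    show "sim_K M \<subseteq> carrier M \<times> carrier M" by (auto dest: sim_K_carrier)
  qed
  moreover have "(x \<otimes>\<^bsub>M\<^esub> c, y \<otimes>\<^bsub>M\<^esub> c) \<in> sim_K M"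
    if xy: "(x, y) \<in> sim_K M" and c: "c \<in> carrier M" for x y c
  proof -
    have cl: "x \<in> carrier M" "y \<in> carrier M" using sim_K_carrier[OF xy] by simp_all
    have "e \<otimes>\<^bsub>M\<^esub> (x \<otimes>\<^bsub>M\<^esub> c) = e \<otimes>\<^bsub>M\<^esub> (y \<otimes>\<^bsub>M\<^esub> c)"
      if e: "e \<in> idempotents M"
        and *: "green_R M (e \<otimes>\<^bsub>M\<^esub> (x \<otimes>\<^bsub>M\<^esub> c)) e \<or> green_R M (e \<otimes>\<^bsub>M\<^esub> (y \<otimes>\<^bsub>M\<^esub> c)) e" for e
    proof -
      have e': "e \<in> carrier M" using e by (simp add: idempotents_def)
      have "green_R M (e \<otimes>\<^bsub>M\<^esub> w) e" if w: "green_R M (e \<otimes>\<^bsub>M\<^esub> (w \<otimes>\<^bsub>M\<^esub> c)) e" "w \<in> carrier M" for w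
      proof -
        obtain s where "s \<in> carrier M" "e \<otimes>\<^bsub>M\<^esub> (w \<otimes>\<^bsub>M\<^esub> c) \<otimes>\<^bsub>M\<^esub> s = e"
          using green_R_mult_iff[of e "w \<otimes>\<^bsub>M\<^esub> c"] w e' c by auto
        then have "\<exists>s \<in> carrier M. e \<otimes>\<^bsub>M\<^esub> w \<otimes>\<^bsub>M\<^esub> s = e"
          using w e' c by (intro bexI[of _ "c \<otimes>\<^bsub>M\<^esub> s"]) (auto simp: m_assoc)
        then show ?thesis using green_R_mult_iff e' w by blast
      qed
      then have "e \<otimes>\<^bsub>M\<^esub> x = e \<otimes>\<^bsub>M\<^esub> y" using sim_K_D[OF xy e] * cl by blast
      then show ?thesis using cl c e' by (simp add: m_assoc[symmetric])
    qed
    then show ?thesis using cl c by (intro sim_K_I) blast+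
  qed
  moreover have "(c \<otimes>\<^bsub>M\<^esub> x, c \<otimes>\<^bsub>M\<^esub> y) \<in> sim_K M"
    if xy: "(x, y) \<in> sim_K M" and c: "c \<in> carrier M" for x y c
  proof -
    have cl: "x \<in> carrier M" "y \<in> carrier M" using sim_K_carrier[OF xy] by simp_all
    have "e \<otimes>\<^bsub>M\<^esub> (c \<otimes>\<^bsub>M\<^esub> x) = e \<otimes>\<^bsub>M\<^esub> (c \<otimes>\<^bsub>M\<^esub> y)"
      if e: "e \<in> idempotents M"
        and *: "green_R M (e \<otimes>\<^bsub>M\<^esub> (c \<otimes>\<^bsub>M\<^esub> x)) e \<or> green_R M (e \<otimes>\<^bsub>M\<^esub> (c \<otimes>\<^bsub>M\<^esub> y)) e" for e
    proof -
      have e': "e \<in> carrier M" "e \<otimes>\<^bsub>M\<^esub> e = e" using e by (auto simp: idempotents_def)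
      \<comment> \<open>\<open>w\<close> is whichever of \<open>x\<close> and \<open>y\<close>
        satisfies the hypothesis, so both alternatives are treated at once.\<close>
      obtain w s where w: "w = x \<or> w = y" and s: "s \<in> carrier M" "e \<otimes>\<^bsub>M\<^esub> (c \<otimes>\<^bsub>M\<^esub> w) \<otimes>\<^bsub>M\<^esub> s = e"
        using * green_R_mult_iff[of e "c \<otimes>\<^bsub>M\<^esub> x"] green_R_mult_iff[of e "c \<otimes>\<^bsub>M\<^esub> y"] e' c cl by auto
      have wc: "w \<in> carrier M" using w cl by auto
      define t where "t = w \<otimes>\<^bsub>M\<^esub> s"
      have t: "t \<in> carrier M" "e \<otimes>\<^bsub>M\<^esub> (c \<otimes>\<^bsub>M\<^esub> t) = e"
        using s wc c e' by (auto simp: t_def m_assoc)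
      \<comment> \<open>Since \<open>e c t = e\<close>, conjugating moves the idempotent past \<open>c\<close>.\<close>
      define d where "d = t \<otimes>\<^bsub>M\<^esub> (e \<otimes>\<^bsub>M\<^esub> c)"
      have ect: "e \<otimes>\<^bsub>M\<^esub> (c \<otimes>\<^bsub>M\<^esub> (t \<otimes>\<^bsub>M\<^esub> v)) = e \<otimes>\<^bsub>M\<^esub> v" if "v \<in> carrier M" for v
        using t that e' c by (metis m_assoc m_closed)
      have ee: "e \<otimes>\<^bsub>M\<^esub> (e \<otimes>\<^bsub>M\<^esub> v) = e \<otimes>\<^bsub>M\<^esub> v" if "v \<in> carrier M" for v
        using that e' by (metis m_assoc)
      have d: "d \<in> idempotents M" "d \<in> carrier M"
        using t e' c ect ee by (auto simp: d_def idempotents_def m_assoc)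
      have "d \<otimes>\<^bsub>M\<^esub> w \<otimes>\<^bsub>M\<^esub> (s \<otimes>\<^bsub>M\<^esub> (e \<otimes>\<^bsub>M\<^esub> c)) = d"
        using t s e' c wc ect ee t_def by (simp add: d_def m_assoc)
      then have "green_R M (d \<otimes>\<^bsub>M\<^esub> w) d"
        using green_R_mult_iff[of d w] d wc s e' c by auto
      then have "d \<otimes>\<^bsub>M\<^esub> x = d \<otimes>\<^bsub>M\<^esub> y" using sim_K_D[OF xy d(1)] w by blast
      \<comment> \<open>Left multiplication by \<open>e c\<close> undoes the conjugation:
        \<open>e c d = e c t e c = e c\<close>.\<close>
      then have "e \<otimes>\<^bsub>M\<^esub> (c \<otimes>\<^bsub>M\<^esub> (d \<otimes>\<^bsub>M\<^esub> x)) = e \<otimes>\<^bsub>M\<^esub> (c \<otimes>\<^bsub>M\<^esub> (d \<otimes>\<^bsub>M\<^esub> y))" by simp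
      then show ?thesis using t cl c e' ect ee by (simp add: d_def m_assoc)
    qed
    then show ?thesis using cl c by (intro sim_K_I) blast+
  qed
  ultimately show ?thesis by (simp add: congruence_def)
qed

section \<open>The identities evaluated in a monoid\<close>

text \<open>\<open>e_prod M a k\<close> is the value of \<open>e\<^sub>k\<^sub>+\<^sub>1 \<cdots> e\<^sub>1\<close> and \<open>f_prod M a k\<close> that of
  \<open>f\<^sub>1 \<cdots> f\<^sub>k\<^sub>+\<^sub>1\<close> under the assignment \<open>a\<close>.\<close>

fun e_prod f_prod :: "('a, 'c) monoid_scheme \<Rightarrow> (var \<Rightarrow> 'a) \<Rightarrow> nat \<Rightarrow> 'a" where
  "e_prod M a 0 = \<one>\<^bsub>M\<^esub>"
| "f_prod M a 0 = \<one>\<^bsub>M\<^esub>"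
| "e_prod M a (Suc k) =
     omega_power M (e_prod M a k \<otimes>\<^bsub>M\<^esub> a Vz \<otimes>\<^bsub>M\<^esub> f_prod M a k \<otimes>\<^bsub>M\<^esub> a (Vx (Suc k))) \<otimes>\<^bsub>M\<^esub> e_prod M a k"
| "f_prod M a (Suc k) =
     f_prod M a k \<otimes>\<^bsub>M\<^esub> omega_power M (a (Vy (Suc k)) \<otimes>\<^bsub>M\<^esub> (e_prod M a k \<otimes>\<^bsub>M\<^esub> a Vz \<otimes>\<^bsub>M\<^esub> f_prod M a k))"

lemma e_f_prod_closed:
  assumes "finite_monoid M" "range a \<subseteq> carrier M"
  shows "e_prod M a k \<in> carrier M \<and> f_prod M a k \<in> carrier M"
proof -
  interpret monoid M using assms by (simp add: finite_monoid_def)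
  have "a v \<in> carrier M" for v using assms by auto
  then show ?thesis by (induction k) (auto intro!: omega_power_closed assms)
qed

text \<open>Variables of index above \<open>k\<close> do not occur in these products. This later
  allows two of them to be reassigned without changing the values.\<close>

lemma e_f_prod_cong:
  assumes "a Vz = b Vz" "\<And>i. i \<le> k \<Longrightarrow> a (Vx i) = b (Vx i)" "\<And>i. i \<le> k \<Longrightarrow> a (Vy i) = b (Vy i)"
  shows "e_prod M a k = e_prod M b k \<and> f_prod M a k = f_prod M b k"
  using assms by (induction k) auto

lemma eval_prod_term_append:
  assumes "finite_monoid M" "\<phi> \<in> monoid_hom word_monoid M"
  shows "eval_term M \<phi> (prod_term (ts @ us)) =
    eval_term M \<phi> (prod_term ts) \<otimes>\<^bsub>M\<^esub> eval_term M \<phi> (prod_term us)"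
proof -
  interpret monoid M using assms by (simp add: finite_monoid_def)
  show ?thesis
    by (induction ts)
      (use eval_term_closed[OF assms] in \<open>auto simp: prod_term_def m_assoc\<close>)
qed

lemma eval_prod_term_single:
  assumes "finite_monoid M" "\<phi> \<in> monoid_hom word_monoid M"
  shows "eval_term M \<phi> (prod_term [t]) = eval_term M \<phi> t"
proof -
  interpret monoid M using assms by (simp add: finite_monoid_def)
  show ?thesis using eval_term_closed[OF assms] by (simp add: prod_term_def)
qed

lemma eval_e_f_prod:
  assumes M: "finite_monoid M" and \<phi>: "\<phi> \<in> monoid_hom word_monoid M"
  shows "eval_term M \<phi> (prod_term (map e_term (rev [1..<Suc (Suc k)]))) = e_prod M (\<lambda>v. \<phi> [v]) k \<and>
    eval_term M \<phi> (prod_term (map f_term [1..<Suc (Suc k)])) = f_prod M (\<lambda>v. \<phi> [v]) k"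
proof (induction k)
  interpret monoid M using M by (simp add: finite_monoid_def)
  case 0
  show ?case by (simp add: prod_term_def)
next
  interpret monoid M using M by (simp add: finite_monoid_def)
  case (Suc k)
  note app = eval_prod_term_append[OF M \<phi>] and one = eval_prod_term_single[OF M \<phi>]
  have cl: "\<phi> [v] \<in> carrier M" "e_prod M (\<lambda>v. \<phi> [v]) k \<in> carrier M" "f_prod M (\<lambda>v. \<phi> [v]) k \<in> carrier M" for v
    using eval_term_closed[OF M \<phi>, of "Var v"] eval_term_closed[OF M \<phi>] Suc by (simp, metis+)
  have e: "e_term (Suc (Suc k)) = Omega (prod_term
      (map e_term (rev [1..<Suc (Suc k)]) @ [Var Vz] @ map f_term [1..<Suc (Suc k)] @ [Var (Vx (Suc k))]))"
    and f: "f_term (Suc (Suc k)) = Omega (prod_term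
      ([Var (Vy (Suc k))] @ map e_term (rev [1..<Suc (Suc k)]) @ [Var Vz] @ map f_term [1..<Suc (Suc k)]))"
    by (subst e_term.simps f_term.simps, simp)+
  have "eval_term M \<phi> (e_term (Suc (Suc k))) = omega_power M (e_prod M (\<lambda>v. \<phi> [v]) k \<otimes>\<^bsub>M\<^esub> \<phi> [Vz]
      \<otimes>\<^bsub>M\<^esub> f_prod M (\<lambda>v. \<phi> [v]) k \<otimes>\<^bsub>M\<^esub> \<phi> [Vx (Suc k)])"
    unfolding e eval_term.simps(4) app one Suc[THEN conjunct1] Suc[THEN conjunct2]
    using cl by (simp add: m_assoc)
  moreover have "eval_term M \<phi> (f_term (Suc (Suc k))) = omega_power M (\<phi> [Vy (Suc k)] \<otimes>\<^bsub>M\<^esub>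
      (e_prod M (\<lambda>v. \<phi> [v]) k \<otimes>\<^bsub>M\<^esub> \<phi> [Vz] \<otimes>\<^bsub>M\<^esub> f_prod M (\<lambda>v. \<phi> [v]) k))"
    unfolding f eval_term.simps(4) app one Suc[THEN conjunct1] Suc[THEN conjunct2]
    using cl by (simp add: m_assoc)
  moreover have "map e_term (rev [1..<Suc (Suc (Suc k))]) =
      [e_term (Suc (Suc k))] @ map e_term (rev [1..<Suc (Suc k)])"
    and "map f_term [1..<Suc (Suc (Suc k))] = map f_term [1..<Suc (Suc k)] @ [f_term (Suc (Suc k))]"
    by (simp_all del: e_term.simps f_term.simps)
  ultimately show ?case using Suc
    by (simp only: app one e_prod.simps f_prod.simps simp_thms)
qed

section \<open>The two identities as statements about assignments of the variables\<close>

text \<open>Replaces homomorphisms by arbitrary assignments, which can be updated at single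
  variables and composed with a permutation of the variables.\<close>

lemma ball_word_hom_iff:
  fixes P :: "('c \<Rightarrow> 'a) \<Rightarrow> bool" and M :: "('a, 'd) monoid_scheme"
  assumes "monoid M"
  shows "(\<forall>\<phi> \<in> monoid_hom word_monoid M. P (\<lambda>v. \<phi> [v])) \<longleftrightarrow> (\<forall>a. range a \<subseteq> carrier M \<longrightarrow> P a)"
proof safe
  fix a :: "'c \<Rightarrow> _" assume *: "\<forall>\<phi> \<in> monoid_hom word_monoid M. P (\<lambda>v. \<phi> [v])" "range a \<subseteq> carrier M"
  then obtain \<phi> where \<phi>: "\<phi> \<in> monoid_hom word_monoid M" "\<And>v. \<phi> [v] = a v"
    using monoid_hom_word_extend[OF assms] by blast
  then have "(\<lambda>v. \<phi> [v]) = a" by auto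
  then show "P a" using * \<phi> by metis
next
  fix \<phi> :: "'c list \<Rightarrow> _" assume "\<forall>a. range a \<subseteq> carrier M \<longrightarrow> P a" "\<phi> \<in> monoid_hom word_monoid M"
  moreover from this have "range (\<lambda>v. \<phi> [v]) \<subseteq> carrier M"
    by (auto simp: monoid_hom_def hom_def word_monoid_def)
  ultimately show "P (\<lambda>v. \<phi> [v])" by blast
qed

abbreviation (input) R_lhs :: "nat \<Rightarrow> var omega_term" where
  "R_lhs m \<equiv> prod_term (map e_term (rev [1..<Suc m]) @ [Var Vz] @ map f_term [1..<m])"

abbreviation (input) R_rhs :: "nat \<Rightarrow> var omega_term" where
  "R_rhs m \<equiv> prod_term (map e_term (rev [1..<Suc m]) @ map f_term [1..<m])"

abbreviation (input) L_lhs :: "nat \<Rightarrow> var omega_term" where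
  "L_lhs m \<equiv> prod_term (map e_term (rev [1..<m]) @ [Var Vz] @ map f_term [1..<Suc m])"

abbreviation (input) L_rhs :: "nat \<Rightarrow> var omega_term" where
  "L_rhs m \<equiv> prod_term (map e_term (rev [1..<m]) @ map f_term [1..<Suc m])"

lemma eval_identity_terms:
  fixes M :: "('a, 'c) monoid_scheme"
  assumes "finite_monoid M" "\<phi> \<in> monoid_hom word_monoid M"
  defines "e \<equiv> e_prod M (\<lambda>v. \<phi> [v])" and "f \<equiv> f_prod M (\<lambda>v. \<phi> [v])"
  shows "eval_term M \<phi> (R_lhs (Suc (Suc k))) = e (Suc k) \<otimes>\<^bsub>M\<^esub> \<phi> [Vz] \<otimes>\<^bsub>M\<^esub> f k"
    and "eval_term M \<phi> (R_rhs (Suc (Suc k))) = e (Suc k) \<otimes>\<^bsub>M\<^esub> f k"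
    and "eval_term M \<phi> (L_lhs (Suc (Suc k))) = e k \<otimes>\<^bsub>M\<^esub> \<phi> [Vz] \<otimes>\<^bsub>M\<^esub> f (Suc k)"
    and "eval_term M \<phi> (L_rhs (Suc (Suc k))) = e k \<otimes>\<^bsub>M\<^esub> f (Suc k)"
proof -
  interpret monoid M using assms by (simp add: finite_monoid_def)
  note ev = eval_e_f_prod[OF assms(1,2), THEN conjunct1] eval_e_f_prod[OF assms(1,2), THEN conjunct2]
  have "\<phi> [Vz] \<in> carrier M" "e i \<in> carrier M" "f i \<in> carrier M" for i
    using eval_term_closed[OF assms(1,2), of "Var Vz"] eval_term_closed[OF assms(1,2)]
    unfolding e_def f_def ev[symmetric] by (simp, blast+)
  then show "eval_term M \<phi> (R_lhs (Suc (Suc k))) = e (Suc k) \<otimes>\<^bsub>M\<^esub> \<phi> [Vz] \<otimes>\<^bsub>M\<^esub> f k"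
    and "eval_term M \<phi> (R_rhs (Suc (Suc k))) = e (Suc k) \<otimes>\<^bsub>M\<^esub> f k"
    and "eval_term M \<phi> (L_lhs (Suc (Suc k))) = e k \<otimes>\<^bsub>M\<^esub> \<phi> [Vz] \<otimes>\<^bsub>M\<^esub> f (Suc k)"
    and "eval_term M \<phi> (L_rhs (Suc (Suc k))) = e k \<otimes>\<^bsub>M\<^esub> f (Suc k)"
    unfolding eval_prod_term_append[OF assms(1,2)] eval_prod_term_single[OF assms(1,2)] ev
      e_def[symmetric] f_def[symmetric] eval_term.simps
    by (simp_all add: m_assoc)
qed

text \<open>The index is shifted by two: \<open>k\<close> belongs to the level
  \<open>m = k + 2\<close>. Thus \<open>e_prod M a (Suc k)\<close> is the product starting with
  \<open>e\<^sub>m\<close>, and \<open>f_prod M a k\<close> ends with the factor of index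
  \<open>m - 1\<close>.\<close>

definition R_identity :: "('a, 'c) monoid_scheme \<Rightarrow> nat \<Rightarrow> bool" where
  "R_identity M k \<longleftrightarrow> (\<forall>a. range a \<subseteq> carrier M \<longrightarrow>
     e_prod M a (Suc k) \<otimes>\<^bsub>M\<^esub> a Vz \<otimes>\<^bsub>M\<^esub> f_prod M a k = e_prod M a (Suc k) \<otimes>\<^bsub>M\<^esub> f_prod M a k)"

definition L_identity :: "('a, 'c) monoid_scheme \<Rightarrow> nat \<Rightarrow> bool" where
  "L_identity M k \<longleftrightarrow> (\<forall>a. range a \<subseteq> carrier M \<longrightarrow>
     e_prod M a k \<otimes>\<^bsub>M\<^esub> a Vz \<otimes>\<^bsub>M\<^esub> f_prod M a (Suc k) = e_prod M a k \<otimes>\<^bsub>M\<^esub> f_prod M a (Suc k))"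

lemma satisfies_R_iff:
  assumes "finite_monoid M"
  shows "satisfies M (R_lhs (Suc (Suc k))) (R_rhs (Suc (Suc k))) \<longleftrightarrow> R_identity M k"
proof -
  have "monoid M" using assms by (simp add: finite_monoid_def)
  then show ?thesis
    unfolding satisfies_def R_identity_def ball_word_hom_iff[OF \<open>monoid M\<close>, symmetric]
    by (intro ball_cong refl) (simp only: eval_identity_terms[OF assms])
qed

lemma satisfies_L_iff:
  assumes "finite_monoid M"
  shows "satisfies M (L_lhs (Suc (Suc k))) (L_rhs (Suc (Suc k))) \<longleftrightarrow> L_identity M k"
proof -
  have "monoid M" using assms by (simp add: finite_monoid_def)
  then show ?thesis
    unfolding satisfies_def L_identity_def ball_word_hom_iff[OF \<open>monoid M\<close>, symmetric]
    by (intro ball_cong refl) (simp only: eval_identity_terms[OF assms])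
qed

section \<open>Idempotents in monoids satisfying the identities\<close>

text \<open>First step towards DA. Substituting \<open>a\<close> for z and \<open>b\<close> for all
  other variables collapses the product of the e's to \<open>ab\<close> and that of the f's to
  \<open>h = baba\<close>, from the first nontrivial factor on. The identity then reads
  \<open>ab a h = ab h\<close>.\<close>

lemma R_identity_idempotent_suffix:
  assumes M: "finite_monoid M" and R: "R_identity M (Suc k)"
    and ab: "a \<in> carrier M" "b \<in> carrier M" "a \<otimes>\<^bsub>M\<^esub> b \<otimes>\<^bsub>M\<^esub> (a \<otimes>\<^bsub>M\<^esub> b) = a \<otimes>\<^bsub>M\<^esub> b"
  shows "a \<otimes>\<^bsub>M\<^esub> b \<otimes>\<^bsub>M\<^esub> b \<otimes>\<^bsub>M\<^esub> (a \<otimes>\<^bsub>M\<^esub> b) = a \<otimes>\<^bsub>M\<^esub> b"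
proof -
  interpret monoid M using M by (simp add: finite_monoid_def)
  have r: "a \<otimes>\<^bsub>M\<^esub> (b \<otimes>\<^bsub>M\<^esub> (a \<otimes>\<^bsub>M\<^esub> b)) = a \<otimes>\<^bsub>M\<^esub> b" using ab by (simp add: m_assoc)
  have r': "a \<otimes>\<^bsub>M\<^esub> (b \<otimes>\<^bsub>M\<^esub> (a \<otimes>\<^bsub>M\<^esub> (b \<otimes>\<^bsub>M\<^esub> w))) = a \<otimes>\<^bsub>M\<^esub> (b \<otimes>\<^bsub>M\<^esub> w)" if "w \<in> carrier M" for w
    using that ab by (metis m_assoc m_closed)
  define h where "h = b \<otimes>\<^bsub>M\<^esub> (a \<otimes>\<^bsub>M\<^esub> (b \<otimes>\<^bsub>M\<^esub> a))"
  have h: "h \<in> carrier M" "h \<otimes>\<^bsub>M\<^esub> h = h" using ab r r' by (auto simp: h_def m_assoc)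
  define c where "c = case_var a (\<lambda>_. b) (\<lambda>_. b)"
  have c: "c Vz = a" "c (Vx i) = b" "c (Vy i) = b" "range c \<subseteq> carrier M" for i
    using ab by (auto simp: c_def split: var.split)
  have og: "omega_power M (a \<otimes>\<^bsub>M\<^esub> b) = a \<otimes>\<^bsub>M\<^esub> b" and oh: "omega_power M h = h"
    using omega_power_of_idempotent[OF M] ab h by auto
  \<comment> \<open>Idempotence of \<open>ab\<close> makes the square of \<open>ba\<close>
    idempotent, whence the exponent 2.\<close>
  have oba: "omega_power M (b \<otimes>\<^bsub>M\<^esub> a) = h"
    by (rule omega_power_eqI[OF M, of _ _ 2])
      (use ab h in \<open>auto simp: idempotents_def h_def m_assoc numeral_2_eq_2\<close>)
  have c_prod: "e_prod M c (Suc i) = a \<otimes>\<^bsub>M\<^esub> b \<and> f_prod M c (Suc i) = h" for i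
  proof (induction i)
    case 0
    then show ?case using ab c og oba h by simp
  next
    case (Suc i)
    have "a \<otimes>\<^bsub>M\<^esub> b \<otimes>\<^bsub>M\<^esub> a \<otimes>\<^bsub>M\<^esub> h \<otimes>\<^bsub>M\<^esub> b = a \<otimes>\<^bsub>M\<^esub> b" "b \<otimes>\<^bsub>M\<^esub> (a \<otimes>\<^bsub>M\<^esub> b \<otimes>\<^bsub>M\<^esub> a \<otimes>\<^bsub>M\<^esub> h) = h"
      using ab r r' by (simp_all add: h_def m_assoc)
    then show ?case
      unfolding e_prod.simps(2)[of M c "Suc i"] f_prod.simps(2)[of M c "Suc i"] c
      using Suc.IH og oh h ab(3) by metis
  qed
  have "a \<otimes>\<^bsub>M\<^esub> b \<otimes>\<^bsub>M\<^esub> a \<otimes>\<^bsub>M\<^esub> h = a \<otimes>\<^bsub>M\<^esub> b \<otimes>\<^bsub>M\<^esub> h"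
    using R c c_prod unfolding R_identity_def by metis
  \<comment> \<open>After multiplication by \<open>b\<close> the left side is a power of
    \<open>ab\<close>, hence \<open>ab\<close>, and the right side is
    \<open>ab b abab = ab b ab\<close>.\<close>
  then have "a \<otimes>\<^bsub>M\<^esub> b \<otimes>\<^bsub>M\<^esub> a \<otimes>\<^bsub>M\<^esub> h \<otimes>\<^bsub>M\<^esub> b = a \<otimes>\<^bsub>M\<^esub> b \<otimes>\<^bsub>M\<^esub> h \<otimes>\<^bsub>M\<^esub> b" by simp
  then show ?thesis using ab r r' by (simp add: h_def m_assoc)
qed

lemma R_identity_idempotent_prefix:
  assumes M: "finite_monoid M" and R: "R_identity M (Suc k)"
    and ab: "a \<in> carrier M" "b \<in> carrier M" "a \<otimes>\<^bsub>M\<^esub> b \<otimes>\<^bsub>M\<^esub> (a \<otimes>\<^bsub>M\<^esub> b) = a \<otimes>\<^bsub>M\<^esub> b"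
  shows "a \<otimes>\<^bsub>M\<^esub> b \<otimes>\<^bsub>M\<^esub> a \<otimes>\<^bsub>M\<^esub> (a \<otimes>\<^bsub>M\<^esub> b) = a \<otimes>\<^bsub>M\<^esub> b"
proof -
  interpret monoid M using M by (simp add: finite_monoid_def)
  have r: "a \<otimes>\<^bsub>M\<^esub> (b \<otimes>\<^bsub>M\<^esub> (a \<otimes>\<^bsub>M\<^esub> b)) = a \<otimes>\<^bsub>M\<^esub> b" using ab by (simp add: m_assoc)
  have r': "a \<otimes>\<^bsub>M\<^esub> (b \<otimes>\<^bsub>M\<^esub> (a \<otimes>\<^bsub>M\<^esub> (b \<otimes>\<^bsub>M\<^esub> w))) = a \<otimes>\<^bsub>M\<^esub> (b \<otimes>\<^bsub>M\<^esub> w)" if "w \<in> carrier M" for w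
    using that ab by (metis m_assoc m_closed)
  \<comment> \<open>The conjugate \<open>(bab)a\<close> of \<open>ab\<close> is an idempotent with suffix \<open>a\<close>.\<close>
  define c where "c = b \<otimes>\<^bsub>M\<^esub> (a \<otimes>\<^bsub>M\<^esub> b)"
  have "c \<otimes>\<^bsub>M\<^esub> a \<otimes>\<^bsub>M\<^esub> a \<otimes>\<^bsub>M\<^esub> (c \<otimes>\<^bsub>M\<^esub> a) = c \<otimes>\<^bsub>M\<^esub> a"
    by (rule R_identity_idempotent_suffix[OF M R]) (use ab r r' in \<open>simp_all add: c_def m_assoc\<close>)
  \<comment> \<open>Multiplying by \<open>a\<close> on the left and \<open>b\<close> on the right
    conjugates back, since \<open>a c a b = ab\<close>.\<close>
  then have "a \<otimes>\<^bsub>M\<^esub> (c \<otimes>\<^bsub>M\<^esub> a \<otimes>\<^bsub>M\<^esub> a \<otimes>\<^bsub>M\<^esub> (c \<otimes>\<^bsub>M\<^esub> a)) \<otimes>\<^bsub>M\<^esub> b = a \<otimes>\<^bsub>M\<^esub> (c \<otimes>\<^bsub>M\<^esub> a) \<otimes>\<^bsub>M\<^esub> b" by simp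
  then show ?thesis using ab r r' by (simp add: c_def m_assoc)
qed

text \<open>A factor is a prefix of a suffix. The suffix rule gives \<open>e b c e = e\<close>,
  which exhibits \<open>e b\<close> as a prefix of the idempotent \<open>e\<close>, and the prefix
  rule applies.\<close>

lemma R_identity_idempotent_factor:
  assumes M: "finite_monoid M" and R: "R_identity M (Suc k)"
    and abc: "a \<in> carrier M" "b \<in> carrier M" "c \<in> carrier M"
    and e: "e \<in> carrier M" "e \<otimes>\<^bsub>M\<^esub> e = e" "a \<otimes>\<^bsub>M\<^esub> (b \<otimes>\<^bsub>M\<^esub> c) = e"
  shows "e \<otimes>\<^bsub>M\<^esub> b \<otimes>\<^bsub>M\<^esub> e = e"
proof -
  interpret monoid M using M by (simp add: finite_monoid_def)
  have "e \<otimes>\<^bsub>M\<^esub> (b \<otimes>\<^bsub>M\<^esub> c) \<otimes>\<^bsub>M\<^esub> e = e"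
    using R_identity_idempotent_suffix[OF M R, of a "b \<otimes>\<^bsub>M\<^esub> c"] abc e by simp
  then have "(e \<otimes>\<^bsub>M\<^esub> b) \<otimes>\<^bsub>M\<^esub> (c \<otimes>\<^bsub>M\<^esub> e) = e" using abc e by (simp add: m_assoc)
  then have "e \<otimes>\<^bsub>M\<^esub> (e \<otimes>\<^bsub>M\<^esub> b) \<otimes>\<^bsub>M\<^esub> e = e"
    using R_identity_idempotent_prefix[OF M R, of "e \<otimes>\<^bsub>M\<^esub> b" "c \<otimes>\<^bsub>M\<^esub> e"] abc e by simp
  then show ?thesis using abc e by (simp add: m_assoc[symmetric])
qed

lemma R_identity_idempotent_mult:
  assumes M: "finite_monoid M" and R: "R_identity M (Suc k)"
    and bc: "b \<in> carrier M" "c \<in> carrier M"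
    and e: "e \<in> carrier M" "e \<otimes>\<^bsub>M\<^esub> e = e"
    and eb: "e \<otimes>\<^bsub>M\<^esub> b \<otimes>\<^bsub>M\<^esub> e = e" and ec: "e \<otimes>\<^bsub>M\<^esub> c \<otimes>\<^bsub>M\<^esub> e = e"
  shows "e \<otimes>\<^bsub>M\<^esub> (b \<otimes>\<^bsub>M\<^esub> c) \<otimes>\<^bsub>M\<^esub> e = e"
proof -
  interpret monoid M using M by (simp add: finite_monoid_def)
  \<comment> \<open>\<open>eb\<close> is an idempotent with factor \<open>c\<close>, as \<open>eb = (ece)b\<close>.\<close>
  have "e \<otimes>\<^bsub>M\<^esub> b \<otimes>\<^bsub>M\<^esub> c \<otimes>\<^bsub>M\<^esub> (e \<otimes>\<^bsub>M\<^esub> b) = e \<otimes>\<^bsub>M\<^esub> b"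
  proof (rule R_identity_idempotent_factor[OF M R, of e c "e \<otimes>\<^bsub>M\<^esub> b"])
    show "e \<otimes>\<^bsub>M\<^esub> b \<otimes>\<^bsub>M\<^esub> (e \<otimes>\<^bsub>M\<^esub> b) = e \<otimes>\<^bsub>M\<^esub> b"
      using bc e eb by (metis m_assoc m_closed)
    show "e \<otimes>\<^bsub>M\<^esub> (c \<otimes>\<^bsub>M\<^esub> (e \<otimes>\<^bsub>M\<^esub> b)) = e \<otimes>\<^bsub>M\<^esub> b"
      using bc e ec by (metis m_assoc m_closed)
  qed (use bc e in simp_all)
  then have "e \<otimes>\<^bsub>M\<^esub> b \<otimes>\<^bsub>M\<^esub> c \<otimes>\<^bsub>M\<^esub> (e \<otimes>\<^bsub>M\<^esub> b) \<otimes>\<^bsub>M\<^esub> e = e \<otimes>\<^bsub>M\<^esub> b \<otimes>\<^bsub>M\<^esub> e" by simp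
  moreover have "e \<otimes>\<^bsub>M\<^esub> b \<otimes>\<^bsub>M\<^esub> c \<otimes>\<^bsub>M\<^esub> (e \<otimes>\<^bsub>M\<^esub> b) \<otimes>\<^bsub>M\<^esub> e = e \<otimes>\<^bsub>M\<^esub> (b \<otimes>\<^bsub>M\<^esub> c) \<otimes>\<^bsub>M\<^esub> (e \<otimes>\<^bsub>M\<^esub> b \<otimes>\<^bsub>M\<^esub> e)"
    using bc e by (simp add: m_assoc)
  ultimately show ?thesis using eb by simp
qed

section \<open>The step of the hierarchy\<close>

lemma R_identity_if_sim_K:
  assumes M: "finite_monoid M"
    and sim: "\<And>a. range a \<subseteq> carrier M \<Longrightarrow>
      (e_prod M a k \<otimes>\<^bsub>M\<^esub> a Vz \<otimes>\<^bsub>M\<^esub> f_prod M a (Suc k), e_prod M a k \<otimes>\<^bsub>M\<^esub> f_prod M a (Suc k)) \<in> sim_K M"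
  shows "R_identity M (Suc k)"
  unfolding R_identity_def
proof safe
  fix a :: "var \<Rightarrow> 'a" assume a: "range a \<subseteq> carrier M"
  interpret monoid M using M by (simp add: finite_monoid_def)
  have cl: "a v \<in> carrier M" "e_prod M a i \<in> carrier M" "f_prod M a i \<in> carrier M" for v i
    using a e_f_prod_closed[OF M a] by auto
  define p u v x where "p = e_prod M a k" and "u = p \<otimes>\<^bsub>M\<^esub> a Vz \<otimes>\<^bsub>M\<^esub> f_prod M a (Suc k)"
    and "v = p \<otimes>\<^bsub>M\<^esub> f_prod M a (Suc k)" and "x = a (Vx (Suc (Suc k)))"
  \<comment> \<open>\<open>d\<close> and \<open>d'\<close> are the values of
    \<open>e\<^sub>k\<^sub>+\<^sub>2\<close> and \<open>e\<^sub>k\<^sub>+\<^sub>3\<close>. The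
    argument of the latter is \<open>d u x\<close>, because the remaining e's and f's and z in it
    multiply to \<open>u\<close>.\<close>
  define d where "d = omega_power M (p \<otimes>\<^bsub>M\<^esub> a Vz \<otimes>\<^bsub>M\<^esub> f_prod M a k \<otimes>\<^bsub>M\<^esub> a (Vx (Suc k)))"
  define d' where "d' = omega_power M (d \<otimes>\<^bsub>M\<^esub> u \<otimes>\<^bsub>M\<^esub> x)"
  have c: "p \<in> carrier M" "u \<in> carrier M" "v \<in> carrier M" "x \<in> carrier M" "d \<in> carrier M"
    using cl by (auto simp del: e_prod.simps f_prod.simps simp: p_def u_def v_def x_def d_def intro!: omega_power_closed[OF M])
  have dd: "d \<otimes>\<^bsub>M\<^esub> d = d" unfolding d_def using cl c
    by (intro omega_power_idem[OF M]) (simp del: e_prod.simps f_prod.simps)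
  have d': "d' \<in> carrier M" "d' \<otimes>\<^bsub>M\<^esub> d' = d'" unfolding d'_def
    using c by (auto intro!: omega_power_idem[OF M] omega_power_closed[OF M])
  obtain t where t: "t \<in> carrier M" "d' = d \<otimes>\<^bsub>M\<^esub> u \<otimes>\<^bsub>M\<^esub> x \<otimes>\<^bsub>M\<^esub> t"
    using omega_power_unfold[OF M, of "d \<otimes>\<^bsub>M\<^esub> u \<otimes>\<^bsub>M\<^esub> x"] c unfolding d'_def by auto
  \<comment> \<open>\<open>d'\<close> begins with the idempotent \<open>d\<close>, which therefore
    acts as a left identity on it. This makes \<open>g = d' d\<close> idempotent.\<close>
  have dd': "d \<otimes>\<^bsub>M\<^esub> d' = d'" using c t dd by (simp add: m_assoc[symmetric])
  define g where "g = d' \<otimes>\<^bsub>M\<^esub> d"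
  have g: "g \<in> idempotents M" "g \<in> carrier M"
    using c d' dd' by (auto simp: g_def idempotents_def) (metis m_assoc m_closed)
  have "g \<otimes>\<^bsub>M\<^esub> u \<otimes>\<^bsub>M\<^esub> (x \<otimes>\<^bsub>M\<^esub> (t \<otimes>\<^bsub>M\<^esub> d)) = d' \<otimes>\<^bsub>M\<^esub> (d \<otimes>\<^bsub>M\<^esub> u \<otimes>\<^bsub>M\<^esub> x \<otimes>\<^bsub>M\<^esub> t) \<otimes>\<^bsub>M\<^esub> d"
    unfolding g_def using c t(1) d'(1) by (simp add: m_assoc)
  also have "\<dots> = d' \<otimes>\<^bsub>M\<^esub> d' \<otimes>\<^bsub>M\<^esub> d" using t(2) by simp
  also have "\<dots> = g" using d' by (simp add: g_def)
  finally have "green_R M (g \<otimes>\<^bsub>M\<^esub> u) g"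
    using green_R_mult_iff[of g u] g c t by blast
  moreover have "(u, v) \<in> sim_K M" using sim[OF a] by (simp only: u_def v_def p_def)
  ultimately have "g \<otimes>\<^bsub>M\<^esub> u = g \<otimes>\<^bsub>M\<^esub> v" using sim_K_D g by metis
  moreover have "e_prod M a (Suc k) = d \<otimes>\<^bsub>M\<^esub> p" by (simp add: d_def p_def)
  moreover from this have "e_prod M a (Suc (Suc k)) = d' \<otimes>\<^bsub>M\<^esub> (d \<otimes>\<^bsub>M\<^esub> p)"
    unfolding e_prod.simps(2)[of M a "Suc k"] d'_def u_def x_def
    using c cl by (simp add: m_assoc del: e_prod.simps f_prod.simps)
  \<comment> \<open>Since \<open>g p\<close> is the full product of the e's, the two sides are
    \<open>g u\<close> and \<open>g v\<close>.\<close>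
  ultimately show "e_prod M a (Suc (Suc k)) \<otimes>\<^bsub>M\<^esub> a Vz \<otimes>\<^bsub>M\<^esub> f_prod M a (Suc k) =
      e_prod M a (Suc (Suc k)) \<otimes>\<^bsub>M\<^esub> f_prod M a (Suc k)"
    using c cl d' by (simp add: g_def u_def v_def m_assoc del: e_prod.simps f_prod.simps)
qed

lemma sim_K_if_R_identity:
  assumes M: "finite_monoid M" and R: "R_identity M (Suc k)" and a: "range a \<subseteq> carrier M"
  shows "(e_prod M a k \<otimes>\<^bsub>M\<^esub> a Vz \<otimes>\<^bsub>M\<^esub> f_prod M a (Suc k), e_prod M a k \<otimes>\<^bsub>M\<^esub> f_prod M a (Suc k)) \<in> sim_K M"
proof -
  interpret monoid M using M by (simp add: finite_monoid_def)
  have cl: "a v \<in> carrier M" "e_prod M a i \<in> carrier M" "f_prod M a i \<in> carrier M" for v i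
    using a e_f_prod_closed[OF M a] by auto
  define p q z where "p = e_prod M a k" and "q = f_prod M a k" and "z = a Vz"
  define y where "y = a (Vy (Suc k))"
  define f where "f = omega_power M (y \<otimes>\<^bsub>M\<^esub> (p \<otimes>\<^bsub>M\<^esub> z \<otimes>\<^bsub>M\<^esub> q))"
  have c: "p \<in> carrier M" "q \<in> carrier M" "z \<in> carrier M" "y \<in> carrier M" "f \<in> carrier M"
    using cl by (auto simp: p_def q_def z_def y_def f_def intro!: omega_power_closed[OF M])
  have qf: "f_prod M a (Suc k) = q \<otimes>\<^bsub>M\<^esub> f" by (simp add: q_def f_def y_def p_def z_def)
  let ?u = "p \<otimes>\<^bsub>M\<^esub> z \<otimes>\<^bsub>M\<^esub> (q \<otimes>\<^bsub>M\<^esub> f)" and ?v = "p \<otimes>\<^bsub>M\<^esub> (q \<otimes>\<^bsub>M\<^esub> f)"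
  \<comment> \<open>The case in which \<open>e u\<close> is R-equivalent to \<open>e\<close>. The
    witness \<open>s\<close> is kept arbitrary, so that the other case can reuse this with
    \<open>s = e\<close>.\<close>
  have main: "e \<otimes>\<^bsub>M\<^esub> ?u = e \<otimes>\<^bsub>M\<^esub> ?v"
    if e: "e \<in> carrier M" "e \<otimes>\<^bsub>M\<^esub> e = e" and s: "s \<in> carrier M" "e \<otimes>\<^bsub>M\<^esub> ?u \<otimes>\<^bsub>M\<^esub> s = e" for e s
  proof -
    \<comment> \<open>\<open>Vx (Suc k)\<close> and \<open>Vx (Suc (Suc k))\<close> do not occur in the two terms compared, so they
      are free to be chosen such that \<open>e\<close> absorbs the two outermost omega powers.\<close>
    define b where "b = a(Vx (Suc k) := f \<otimes>\<^bsub>M\<^esub> s \<otimes>\<^bsub>M\<^esub> e, Vx (Suc (Suc k)) := s \<otimes>\<^bsub>M\<^esub> e)"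
    have b: "range b \<subseteq> carrier M" using cl c s e by (auto simp: b_def)
    have pq: "e_prod M b k = p" "f_prod M b k = q"
      using e_f_prod_cong[of b a k M] by (auto simp: b_def p_def q_def)
    have bs: "b Vz = z" "b (Vy (Suc k)) = y" "b (Vx (Suc k)) = f \<otimes>\<^bsub>M\<^esub> s \<otimes>\<^bsub>M\<^esub> e" "b (Vx (Suc (Suc k))) = s \<otimes>\<^bsub>M\<^esub> e"
      by (auto simp: b_def z_def y_def)
    define d where "d = omega_power M (p \<otimes>\<^bsub>M\<^esub> z \<otimes>\<^bsub>M\<^esub> q \<otimes>\<^bsub>M\<^esub> (f \<otimes>\<^bsub>M\<^esub> s \<otimes>\<^bsub>M\<^esub> e))"
    define d' where "d' = omega_power M (d \<otimes>\<^bsub>M\<^esub> p \<otimes>\<^bsub>M\<^esub> z \<otimes>\<^bsub>M\<^esub> (q \<otimes>\<^bsub>M\<^esub> f) \<otimes>\<^bsub>M\<^esub> (s \<otimes>\<^bsub>M\<^esub> e))"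
    have "d \<in> carrier M" using c s e by (auto simp: d_def intro!: omega_power_closed[OF M])
    moreover from this have "d' \<in> carrier M" unfolding d'_def using c s e
      by (intro omega_power_closed[OF M]) simp
    ultimately have dc: "d \<in> carrier M" "d' \<in> carrier M" .
    have e_use: "e \<otimes>\<^bsub>M\<^esub> (p \<otimes>\<^bsub>M\<^esub> (z \<otimes>\<^bsub>M\<^esub> (q \<otimes>\<^bsub>M\<^esub> (f \<otimes>\<^bsub>M\<^esub> (s \<otimes>\<^bsub>M\<^esub> e))))) = e"
    proof -
      have "e \<otimes>\<^bsub>M\<^esub> ?u \<otimes>\<^bsub>M\<^esub> s \<otimes>\<^bsub>M\<^esub> e = e" using s e by simp
      then show ?thesis using c s(1) e(1) by (simp add: m_assoc)
    qed
    \<comment> \<open>With the chosen values the argument of \<open>d\<close> is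
      \<open>u s e\<close>, which fixes \<open>e\<close> from the right. Once \<open>e\<close>
      absorbs \<open>d\<close>, the argument \<open>d u s e\<close> of \<open>d'\<close> fixes
      \<open>e\<close> as well.\<close>
    have ed: "e \<otimes>\<^bsub>M\<^esub> d = e" unfolding d_def
      by (rule mult_omega_power_absorb[OF M]) (use c s(1) e e_use in \<open>simp_all add: m_assoc\<close>)
    have edw: "e \<otimes>\<^bsub>M\<^esub> (d \<otimes>\<^bsub>M\<^esub> w) = e \<otimes>\<^bsub>M\<^esub> w" if "w \<in> carrier M" for w
      using that ed dc e by (metis m_assoc)
    have ed': "e \<otimes>\<^bsub>M\<^esub> d' = e" unfolding d'_def
      by (rule mult_omega_power_absorb[OF M]) (use c s(1) e dc e_use edw in \<open>simp_all add: m_assoc\<close>)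
    have edw': "e \<otimes>\<^bsub>M\<^esub> (d' \<otimes>\<^bsub>M\<^esub> w) = e \<otimes>\<^bsub>M\<^esub> w" if "w \<in> carrier M" for w
      using that ed' dc e by (metis m_assoc)
    have fb: "f_prod M b (Suc k) = q \<otimes>\<^bsub>M\<^esub> f" by (simp add: pq bs f_def)
    have eb: "e_prod M b (Suc k) = d \<otimes>\<^bsub>M\<^esub> p" by (simp add: pq bs d_def)
    have eb': "e_prod M b (Suc (Suc k)) = d' \<otimes>\<^bsub>M\<^esub> (d \<otimes>\<^bsub>M\<^esub> p)"
      unfolding e_prod.simps(2)[of M b "Suc k"] eb fb bs d'_def by simp
    have "d' \<otimes>\<^bsub>M\<^esub> (d \<otimes>\<^bsub>M\<^esub> p) \<otimes>\<^bsub>M\<^esub> z \<otimes>\<^bsub>M\<^esub> (q \<otimes>\<^bsub>M\<^esub> f) = d' \<otimes>\<^bsub>M\<^esub> (d \<otimes>\<^bsub>M\<^esub> p) \<otimes>\<^bsub>M\<^esub> (q \<otimes>\<^bsub>M\<^esub> f)"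
      using R b eb' fb bs(1) unfolding R_identity_def by metis
    then have "e \<otimes>\<^bsub>M\<^esub> (d' \<otimes>\<^bsub>M\<^esub> (d \<otimes>\<^bsub>M\<^esub> p) \<otimes>\<^bsub>M\<^esub> z \<otimes>\<^bsub>M\<^esub> (q \<otimes>\<^bsub>M\<^esub> f)) =
        e \<otimes>\<^bsub>M\<^esub> (d' \<otimes>\<^bsub>M\<^esub> (d \<otimes>\<^bsub>M\<^esub> p) \<otimes>\<^bsub>M\<^esub> (q \<otimes>\<^bsub>M\<^esub> f))" by simp
    then show ?thesis using c e dc edw edw' by (simp add: m_assoc)
  qed
  have "(?u, ?v) \<in> sim_K M"
  proof (rule sim_K_I)
    fix e assume e': "e \<in> idempotents M" and "green_R M (e \<otimes>\<^bsub>M\<^esub> ?u) e \<or> green_R M (e \<otimes>\<^bsub>M\<^esub> ?v) e"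
    then consider s where "s \<in> carrier M" "e \<otimes>\<^bsub>M\<^esub> ?u \<otimes>\<^bsub>M\<^esub> s = e"
      | s where "s \<in> carrier M" "e \<otimes>\<^bsub>M\<^esub> ?v \<otimes>\<^bsub>M\<^esub> s = e"
      using green_R_mult_iff[of e ?u] green_R_mult_iff[of e ?v] c by (auto simp: idempotents_def)
    then show "e \<otimes>\<^bsub>M\<^esub> ?u = e \<otimes>\<^bsub>M\<^esub> ?v"
    proof cases
      case 1
      then show ?thesis using main e' by (simp add: idempotents_def)
    next
      case (2 s)
      have e: "e \<in> carrier M" "e \<otimes>\<^bsub>M\<^esub> e = e" using e' by (auto simp: idempotents_def)
      note factor = R_identity_idempotent_factor[OF M R _ _ _ e]
      note mult = R_identity_idempotent_mult[OF M R _ _ e]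
      \<comment> \<open>The omega power \<open>f\<close> begins with \<open>y p z q\<close>. This is
        how z is found as a factor of \<open>e v s = e\<close>, although v arises from u by deleting
        the middle z.\<close>
      obtain t where t: "t \<in> carrier M" "f = y \<otimes>\<^bsub>M\<^esub> (p \<otimes>\<^bsub>M\<^esub> z \<otimes>\<^bsub>M\<^esub> q) \<otimes>\<^bsub>M\<^esub> t"
        using omega_power_unfold[OF M, of "y \<otimes>\<^bsub>M\<^esub> (p \<otimes>\<^bsub>M\<^esub> z \<otimes>\<^bsub>M\<^esub> q)"] c unfolding f_def by auto
      have "e \<otimes>\<^bsub>M\<^esub> p \<otimes>\<^bsub>M\<^esub> e = e"
        by (rule factor[of e p "q \<otimes>\<^bsub>M\<^esub> f \<otimes>\<^bsub>M\<^esub> s"]) (use 2 c e in \<open>simp_all add: m_assoc\<close>)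
      moreover have "e \<otimes>\<^bsub>M\<^esub> (q \<otimes>\<^bsub>M\<^esub> f) \<otimes>\<^bsub>M\<^esub> e = e"
        by (rule factor[of "e \<otimes>\<^bsub>M\<^esub> p" "q \<otimes>\<^bsub>M\<^esub> f" s]) (use 2 c e in \<open>simp_all add: m_assoc\<close>)
      moreover have "e \<otimes>\<^bsub>M\<^esub> z \<otimes>\<^bsub>M\<^esub> e = e"
      proof (rule factor)
        have "e \<otimes>\<^bsub>M\<^esub> (p \<otimes>\<^bsub>M\<^esub> (q \<otimes>\<^bsub>M\<^esub> (y \<otimes>\<^bsub>M\<^esub> (p \<otimes>\<^bsub>M\<^esub> z \<otimes>\<^bsub>M\<^esub> q) \<otimes>\<^bsub>M\<^esub> t))) \<otimes>\<^bsub>M\<^esub> s = e"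
          using 2 t by simp
        then show "(e \<otimes>\<^bsub>M\<^esub> p \<otimes>\<^bsub>M\<^esub> q \<otimes>\<^bsub>M\<^esub> y \<otimes>\<^bsub>M\<^esub> p) \<otimes>\<^bsub>M\<^esub> (z \<otimes>\<^bsub>M\<^esub> (q \<otimes>\<^bsub>M\<^esub> t \<otimes>\<^bsub>M\<^esub> s)) = e"
          using c e t(1) 2(1) by (simp add: m_assoc)
      qed (use c e t 2 in simp_all)
      \<comment> \<open>All three factors of \<open>u\<close> lie in the set of \<open>b\<close>
        with \<open>e b e = e\<close>, which is closed under products.\<close>
      ultimately have "e \<otimes>\<^bsub>M\<^esub> ?u \<otimes>\<^bsub>M\<^esub> e = e"
        using c mult[of p z] mult[of "p \<otimes>\<^bsub>M\<^esub> z" "q \<otimes>\<^bsub>M\<^esub> f"] by simp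
      then show ?thesis using main e by simp
    qed
  qed (use c in simp_all)
  then show ?thesis unfolding qf p_def[symmetric] z_def[symmetric] .
qed

section \<open>The opposite monoid\<close>

definition opposite :: "('a, 'c) monoid_scheme \<Rightarrow> 'a monoid" where
  "opposite M = \<lparr>carrier = carrier M, mult = (\<lambda>x y. y \<otimes>\<^bsub>M\<^esub> x), one = \<one>\<^bsub>M\<^esub>\<rparr>"

lemma opposite_simps [simp]:
  "carrier (opposite M) = carrier M" "x \<otimes>\<^bsub>opposite M\<^esub> y = y \<otimes>\<^bsub>M\<^esub> x" "\<one>\<^bsub>opposite M\<^esub> = \<one>\<^bsub>M\<^esub>"
  by (simp_all add: opposite_def)

lemma finite_monoid_opposite:
  assumes "finite_monoid M"
  shows "finite_monoid (opposite M)"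
proof -
  interpret monoid M using assms by (simp add: finite_monoid_def)
  have "monoid (opposite M)" by (rule monoidI) (auto simp: m_assoc)
  then show ?thesis using assms by (simp add: finite_monoid_def)
qed

lemma omega_power_opposite:
  assumes "finite_monoid M" "a \<in> carrier M"
  shows "omega_power (opposite M) a = omega_power M a"
proof -
  interpret monoid M using assms by (simp add: finite_monoid_def)
  interpret O: monoid "opposite M" using finite_monoid_opposite[OF assms(1)] by (simp add: finite_monoid_def)
  have pow: "a [^]\<^bsub>opposite M\<^esub> n = a [^]\<^bsub>M\<^esub> n" for n :: nat
  proof (induction n)
    case (Suc n)
    then show ?case using nat_pow_Suc2[OF assms(2), of n] by simp
  qed simp
  show ?thesis by (simp add: omega_power_def idempotents_def pow)
qed

text \<open>Reversing the argument of \<open>e\<^sub>i\<^sub>+\<^sub>1\<close> and exchanging the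
  x's with the y's gives the argument of \<open>f\<^sub>i\<^sub>+\<^sub>1\<close>, so passing to the
  opposite monoid along this renaming interchanges the two families.\<close>

primrec swap_var :: "var \<Rightarrow> var" where
  "swap_var Vz = Vz"
| "swap_var (Vx i) = Vy i"
| "swap_var (Vy i) = Vx i"

lemma swap_var_swap_var [simp]: "swap_var (swap_var v) = v"
  by (cases v) auto

lemma e_f_prod_opposite:
  assumes M: "finite_monoid M" and a: "range a \<subseteq> carrier M"
  shows "e_prod (opposite M) (a \<circ> swap_var) k = f_prod M a k \<and>
    f_prod (opposite M) (a \<circ> swap_var) k = e_prod M a k"
proof (induction k)
  interpret monoid M using M by (simp add: finite_monoid_def)
  case (Suc k)
  have cl: "a v \<in> carrier M" "e_prod M a i \<in> carrier M" "f_prod M a i \<in> carrier M" for v i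
    using a e_f_prod_closed[OF M a] by auto
  show ?case using Suc cl by (simp add: omega_power_opposite[OF M] m_assoc)
qed simp

text \<open>Renaming by the involution \<open>swap_var\<close> permutes the assignments into
  \<open>C\<close>.\<close>

lemma all_assignment_swap:
  fixes P :: "(var \<Rightarrow> 'a) \<Rightarrow> bool"
  shows "(\<forall>a. range a \<subseteq> C \<longrightarrow> P a) \<longleftrightarrow> (\<forall>a. range a \<subseteq> C \<longrightarrow> P (a \<circ> swap_var))"
proof (intro iffI allI impI)
  fix a :: "var \<Rightarrow> 'a"
  assume *: "\<forall>a. range a \<subseteq> C \<longrightarrow> P (a \<circ> swap_var)" and a: "range a \<subseteq> C"
  have "range (a \<circ> swap_var) \<subseteq> C" using a by auto
  with * have "P ((a \<circ> swap_var) \<circ> swap_var)" by blast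
  moreover have "(a \<circ> swap_var) \<circ> swap_var = a" by (simp add: comp_def)
  ultimately show "P a" by simp
next
  fix a :: "var \<Rightarrow> 'a"
  assume *: "\<forall>a. range a \<subseteq> C \<longrightarrow> P a" and a: "range a \<subseteq> C"
  have "range (a \<circ> swap_var) \<subseteq> C" using a by auto
  with * show "P (a \<circ> swap_var)" by blast
qed

lemma R_identity_opposite:
  assumes M: "finite_monoid M"
  shows "R_identity (opposite M) k \<longleftrightarrow> L_identity M k"
proof -
  interpret monoid M using M by (simp add: finite_monoid_def)
  have "e_prod (opposite M) (a \<circ> swap_var) (Suc k) \<otimes>\<^bsub>opposite M\<^esub> (a \<circ> swap_var) Vz \<otimes>\<^bsub>opposite M\<^esub>
        f_prod (opposite M) (a \<circ> swap_var) k =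
      e_prod M a k \<otimes>\<^bsub>M\<^esub> a Vz \<otimes>\<^bsub>M\<^esub> f_prod M a (Suc k)"
    if a: "range a \<subseteq> carrier M" for a
  proof -
    have "a Vz \<in> carrier M" using a by auto
    then show ?thesis
      using e_f_prod_closed[OF M a] by (simp add: e_f_prod_opposite[OF M a] m_assoc del: e_prod.simps f_prod.simps)
  qed
  then show ?thesis
    unfolding R_identity_def L_identity_def opposite_simps(1)
    by (subst all_assignment_swap) (simp add: e_f_prod_opposite[OF M] del: e_prod.simps f_prod.simps cong: imp_cong)
qed

text \<open>Reversal keeps the idempotents and turns L into R, so all facts on \<open>sim_D\<close>
  follow from those on \<open>sim_K\<close>.\<close>

lemma sim_D_eq: "sim_D M = sim_K (opposite M)"
  by (simp add: sim_D_def sim_K_def green_L_def green_R_def l_coset_def r_coset_def idempotents_def)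

lemma sim_D_congruence:
  assumes "finite_monoid M"
  shows "congruence M (sim_D M)"
proof -
  have "congruence (opposite M) (sim_K (opposite M))"
    using finite_monoid_opposite[OF assms] by (intro sim_K_congruence) (simp add: finite_monoid_def)
  then show ?thesis by (auto simp: congruence_def sim_D_eq)
qed

lemma sim_K_iff_R_identity:
  assumes "finite_monoid M"
  shows "(\<forall>a. range a \<subseteq> carrier M \<longrightarrow>
      (e_prod M a k \<otimes>\<^bsub>M\<^esub> a Vz \<otimes>\<^bsub>M\<^esub> f_prod M a (Suc k), e_prod M a k \<otimes>\<^bsub>M\<^esub> f_prod M a (Suc k)) \<in> sim_K M)
    \<longleftrightarrow> R_identity M (Suc k)"
  using R_identity_if_sim_K[OF assms] sim_K_if_R_identity[OF assms] by blast

lemma sim_D_iff_L_identity: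
  assumes M: "finite_monoid M"
  shows "(\<forall>a. range a \<subseteq> carrier M \<longrightarrow>
      (e_prod M a (Suc k) \<otimes>\<^bsub>M\<^esub> a Vz \<otimes>\<^bsub>M\<^esub> f_prod M a k, e_prod M a (Suc k) \<otimes>\<^bsub>M\<^esub> f_prod M a k) \<in> sim_D M)
    \<longleftrightarrow> L_identity M (Suc k)"
proof -
  interpret monoid M using M by (simp add: finite_monoid_def)
  have "e_prod (opposite M) (a \<circ> swap_var) k \<otimes>\<^bsub>opposite M\<^esub> (a \<circ> swap_var) Vz \<otimes>\<^bsub>opposite M\<^esub>
        f_prod (opposite M) (a \<circ> swap_var) (Suc k) =
      e_prod M a (Suc k) \<otimes>\<^bsub>M\<^esub> a Vz \<otimes>\<^bsub>M\<^esub> f_prod M a k"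
    if a: "range a \<subseteq> carrier M" for a
  proof -
    have "a Vz \<in> carrier M" using a by auto
    then show ?thesis
      using e_f_prod_closed[OF M a] by (simp add: e_f_prod_opposite[OF M a] m_assoc del: e_prod.simps f_prod.simps)
  qed
  \<comment> \<open>After unfolding, both sides quantify over assignments; the renaming is applied
    only to the second quantifier, whose products are formed in the opposite monoid.\<close>
  then show ?thesis
    unfolding R_identity_opposite[OF M, symmetric] sim_K_iff_R_identity[OF finite_monoid_opposite[OF M], symmetric]
      sim_D_eq opposite_simps(1)
    by (subst (2) all_assignment_swap) (simp add: e_f_prod_opposite[OF M] del: e_prod.simps f_prod.simps cong: imp_cong)
qed

section \<open>Induction along the hierarchy\<close>

text \<open>Both equations are proved simultaneously because each step of the recursion passes from
  one family of classes to the other.\<close>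

lemma TW_eq:
  "(TW_R (Suc (Suc k)) :: 'a monoid set) = equation_class (R_lhs (Suc (Suc k))) (R_rhs (Suc (Suc k))) \<and>
   (TW_L (Suc (Suc k)) :: 'a monoid set) = equation_class (L_lhs (Suc (Suc k))) (L_rhs (Suc (Suc k)))"
proof (induction k)
  case 0
  \<comment> \<open>At level 2 only \<open>e\<^sub>2\<close> or \<open>f\<^sub>2\<close> differs
    from 1, so the general identities evaluate to the defining ones.\<close>
  have "satisfies M (Times (Omega (Times (Var Vz) (Var (Vx 1)))) (Var Vz)) (Omega (Times (Var Vz) (Var (Vx 1))))
      \<longleftrightarrow> satisfies M (R_lhs (Suc (Suc 0))) (R_rhs (Suc (Suc 0)))"
    and "satisfies M (Times (Var Vz) (Omega (Times (Var (Vy 1)) (Var Vz)))) (Omega (Times (Var (Vy 1)) (Var Vz)))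
      \<longleftrightarrow> satisfies M (L_lhs (Suc (Suc 0))) (L_rhs (Suc (Suc 0)))"
    if M: "finite_monoid M" for M :: "'a monoid"
  proof -
    interpret monoid M using M by (simp add: finite_monoid_def)
    have cl: "\<phi> [v] \<in> carrier M" if "\<phi> \<in> monoid_hom word_monoid M" for \<phi> and v :: var
      using eval_term_closed[OF M that, of "Var v"] by simp
    have "eval_term M \<phi> (Times (Omega (Times (Var Vz) (Var (Vx 1)))) (Var Vz)) = eval_term M \<phi> (R_lhs (Suc (Suc 0)))"
      and "eval_term M \<phi> (Omega (Times (Var Vz) (Var (Vx 1)))) = eval_term M \<phi> (R_rhs (Suc (Suc 0)))"
      and "eval_term M \<phi> (Times (Var Vz) (Omega (Times (Var (Vy 1)) (Var Vz)))) = eval_term M \<phi> (L_lhs (Suc (Suc 0)))"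
      and "eval_term M \<phi> (Omega (Times (Var (Vy 1)) (Var Vz))) = eval_term M \<phi> (L_rhs (Suc (Suc 0)))"
      if \<phi>: "\<phi> \<in> monoid_hom word_monoid M" for \<phi>
      unfolding eval_identity_terms[OF M \<phi>] using cl[OF \<phi>]
      by (simp_all add: omega_power_closed[OF M])
    then show "satisfies M (Times (Omega (Times (Var Vz) (Var (Vx 1)))) (Var Vz)) (Omega (Times (Var Vz) (Var (Vx 1))))
        \<longleftrightarrow> satisfies M (R_lhs (Suc (Suc 0))) (R_rhs (Suc (Suc 0)))"
      and "satisfies M (Times (Var Vz) (Omega (Times (Var (Vy 1)) (Var Vz)))) (Omega (Times (Var (Vy 1)) (Var Vz)))
        \<longleftrightarrow> satisfies M (L_lhs (Suc (Suc 0))) (L_rhs (Suc (Suc 0)))"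
      unfolding satisfies_def by metis+
  qed
  then show ?case by (auto simp: equation_class_def simp del: e_term.simps f_term.simps)
next
  case (Suc k)
  \<comment> \<open>By the induction hypothesis the class is equational, so membership of the
    quotient says that the values of both sides in \<open>M\<close> are related by the congruence.
    This is the identity of the next level by \<open>sim_K_iff_R_identity\<close> and
    \<open>sim_D_iff_L_identity\<close>.\<close>
  have "in_class (quotient_monoid M (sim_K M)) (TW_L (Suc (Suc k)) :: 'a monoid set) \<longleftrightarrow>
      satisfies M (R_lhs (Suc (Suc (Suc k)))) (R_rhs (Suc (Suc (Suc k))))"
    and "in_class (quotient_monoid M (sim_D M)) (TW_R (Suc (Suc k)) :: 'a monoid set) \<longleftrightarrow>
      satisfies M (L_lhs (Suc (Suc (Suc k)))) (L_rhs (Suc (Suc (Suc k))))"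
    if M: "finite_monoid M" for M :: "'a monoid"
  proof -
    have mono: "monoid M" using M by (simp add: finite_monoid_def)
    show "in_class (quotient_monoid M (sim_K M)) (TW_L (Suc (Suc k)) :: 'a monoid set) \<longleftrightarrow>
        satisfies M (R_lhs (Suc (Suc (Suc k)))) (R_rhs (Suc (Suc (Suc k))))"
      unfolding Suc[THEN conjunct2] in_class_quotient_iff[OF M sim_K_congruence[OF mono]]
        satisfies_R_iff[OF M] sim_K_iff_R_identity[OF M, symmetric] ball_word_hom_iff[OF mono, symmetric]
      by (intro ball_cong refl) (simp only: eval_identity_terms[OF M])
    show "in_class (quotient_monoid M (sim_D M)) (TW_R (Suc (Suc k)) :: 'a monoid set) \<longleftrightarrow>
        satisfies M (L_lhs (Suc (Suc (Suc k)))) (L_rhs (Suc (Suc (Suc k))))"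
      unfolding Suc[THEN conjunct1] in_class_quotient_iff[OF M sim_D_congruence[OF M]]
        satisfies_L_iff[OF M] sim_D_iff_L_identity[OF M, symmetric] ball_word_hom_iff[OF mono, symmetric]
      by (intro ball_cong refl) (simp only: eval_identity_terms[OF M])
  qed
  then show ?case
    by (auto simp only: TW_R.simps TW_L.simps malcev_K_def malcev_D_def equation_class_def[of "R_lhs (Suc (Suc (Suc k)))"]
      equation_class_def[of "L_lhs (Suc (Suc (Suc k)))"])
qed

theorem proposition1:
  fixes m :: nat
  assumes "m \<ge> 2"
  shows
    "(TW_R m :: 'a monoid set) =
       equation_class
         (prod_term (map e_term (rev [1..<Suc m]) @ [Var Vz] @ map f_term [1..<m]))
         (prod_term (map e_term (rev [1..<Suc m]) @ map f_term [1..<m]))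
     \<and>
     (TW_L m :: 'a monoid set) =
       equation_class
         (prod_term (map e_term (rev [1..<m]) @ [Var Vz] @ map f_term [1..<Suc m]))
         (prod_term (map e_term (rev [1..<m]) @ map f_term [1..<Suc m]))"
proof -
  obtain k where "m = 2 + k" using le_Suc_ex[OF assms] by blast
  then have "m = Suc (Suc k)" by simp
  then show ?thesis using TW_eq[of k] by (simp only:)
qed

end
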